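(* Let $F$ and $G$ be experiments on the state space $\Theta=\{\theta_0,\ldots,\theta_n\}$. Then $F\succeq_{\textup{LB}}G$ if and only if $W_F(\mathcal{E})\ge W_G(\mathcal{E})$ for every screening environment $\mathcal{E}$.
   Context: $\Theta=\{\theta_0,\ldots,\theta_n\}\subset\mathbb{R}$. An experiment $F$ specifies, for each $\theta$, an absolutely continuous distribution $F(\cdot\mid\theta)$ with density $f(\cdot\mid\theta)$ of a signal in a compact interval $\mathcal{X}$; likewise $G$ on a compact interval $\mathcal{Y}$. $\widehat{\Delta}_n=\{\boldsymbol{q}\in[0,1]^n:\sum_iq_i\le1\}$, a vector $\boldsymbol{p}\in\widehat{\Delta}_n$ representing the distribution on $\Theta$ with mass $p_i$ on $\theta_i$ ($i\ge1$) and $p_0=1-\sum_ip_i$ on $\theta_0$. LB order: with $p_{F,i}(x;\boldsymbol{q})=q_if(x\mid\theta_i)/\sum_jq_jf(x\mid\theta_j)$ and $\boldsymbol{p}_F(\boldsymbol{q})=(p_{F,1},\ldots,p_{F,n})(X;\boldsymbol{q})$, $X\sim\sum_jq_jF(\cdot\mid\theta_j)$, $F\succeq_{\textup{LB}}G$ means $\mathbb{E}[C(\boldsymbol{b}\cdot\boldsymbol{p}_F(\boldsymbol{q}))]\ge\mathbb{E}[C(\boldsymbol{b}\cdot\boldsymbol{p}_G(\boldsymbol{q}))]$ for all $\boldsymbol{q}\in\widehat{\Delta}_n$, $\boldsymbol{b}\in\mathbb{R}^n$ and convex $C:\mathbb{R}\to\mathbb{R}$. A screening environment $\mathcal{E}=\{\mathcal{A},\boldsymbol{q},\mathcal{P},\pi,\psi,v_1,v_2,u_1,\boldsymbol{m}\}$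 consists of a finite set of alternatives $\mathcal{A}=\{a_0,\ldots,a_k\}$; a common prior $\boldsymbol{q}\in\widehat{\Delta}_n$; a finite set of agent types $\mathcal{P}\subset\widehat{\Delta}_n$ with distribution $\pi\in\Delta(\mathcal{P})$ satisfying $\mathbb{E}_\pi[\boldsymbol{P}]=\boldsymbol{q}$ (type $\boldsymbol{p}$ is the agent's belief about $\theta$); $\psi:\mathcal{A}\to[0,1]$; $v_1,u_1:\mathcal{A}\times\Theta\to\mathbb{R}$; $v_2:\mathbb{R}\to\mathbb{R}$ continuous and convex; and $\boldsymbol{m}=(\underline{m},\overline{m})$ with $\underline{m}<\overline{m}$. Timing: the agent learns his type $\boldsymbol{p}$ (drawn from $\pi$; given $\boldsymbol{p}$, $\theta$ is distributed according to $\boldsymbol{p}$), reports a type $\boldsymbol{p}'\in\mathcal{P}$, an alternative $a$ is drawn from $\hat{a}(\boldsymbol{p}')$; then with probability $\psi(a)$ a signal $x\sim F(\cdot\mid\theta)$ is publicly observed, and with probability $1-\psi(a)$ the uninformative signal $\perp$ is observed; let $\overline{\mathcal{X}}=\mathcal{X}\cup\{\perp\}$. Then the transfer $t=\hat{t}(\boldsymbol{p}',a,x)$ is paid to the agent. A mechanism consists of an allocation rule $\hat{a}:\mathcal{P}\to\Delta(\mathcal{A})$ and a Borel-measurable transfer rule $\hat{t}:\mathcal{P}\times\mathcal{A}\times\overline{\mathcal{X}}\to[\underline{m},\overline{m}]$ (the set of such $\hat{t}$ is $\mathcal{T}^{\boldsymbol{m}}_F$). Payoffs: principal $v_1(a,\theta)-v_2(t)$,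 agent $u_1(a,\theta)+t$. Let $U(\boldsymbol{p},\boldsymbol{p}')=\mathbb{E}[u_1(a,\theta)+\hat{t}(\boldsymbol{p}',a,x)]$, expectation over $\theta\sim\boldsymbol{p}$, $a\sim\hat{a}(\boldsymbol{p}')$ and the signal as described. Then $W_F(\mathcal{E})=\sup_{\hat{a},\,\hat{t}\in\mathcal{T}^{\boldsymbol{m}}_F}\mathbb{E}[v_1(a,\theta)-v_2(\hat{t}(\boldsymbol{P},a,x))]$ (expectation over $\boldsymbol{P}\sim\pi$, $\theta\sim\boldsymbol{P}$, $a\sim\hat{a}(\boldsymbol{P})$, and the signal), subject to (IR) $U(\boldsymbol{p},\boldsymbol{p})\ge0$ for all $\boldsymbol{p}\in\mathcal{P}$ and (IC) $U(\boldsymbol{p},\boldsymbol{p})\ge U(\boldsymbol{p},\boldsymbol{p}')$ for all $\boldsymbol{p},\boldsymbol{p}'\in\mathcal{P}$. $W_G(\mathcal{E})$ is defined analogously with $G$ generating the signal on $\mathcal{Y}$. *)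

theory Defs
  imports "HOL-Analysis.Analysis"
begin

text \<open>States \<theta>_0,...,\<theta>_n are represented by their indices 0..n.
  A vector q in the truncated tsimplex is a function nat => real, supported on {1..n}.\<close>

definition tsimplex :: "nat \<Rightarrow> (nat \<Rightarrow> real) set" where
  "tsimplex n = {q. (\<forall>i. i \<notin> {1..n} \<longrightarrow> q i = 0) \<and> (\<forall>i\<in>{1..n}. 0 \<le> q i \<and> q i \<le> 1)
                   \<and> sum q {1..n} \<le> 1}"

definition fullp :: "nat \<Rightarrow> (nat \<Rightarrow> real) \<Rightarrow> nat \<Rightarrow> real" where
  "fullp n q i = (if i = 0 then 1 - sum q {1..n} else q i)"

definition is_experiment :: "nat \<Rightarrow> real \<Rightarrow> real \<Rightarrow> (nat \<Rightarrow> real \<Rightarrow> real) \<Rightarrow> bool" where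
  "is_experiment n xl xu f \<longleftrightarrow> xl \<le> xu \<and>
     (\<forall>i\<in>{0..n}. (\<forall>x\<in>{xl..xu}. 0 \<le> f i x) \<and> set_integrable lborel {xl..xu} (f i)
        \<and> (LINT x:{xl..xu}|lborel. f i x) = 1)"

definition mixd :: "nat \<Rightarrow> (nat \<Rightarrow> real \<Rightarrow> real) \<Rightarrow> (nat \<Rightarrow> real) \<Rightarrow> real \<Rightarrow> real" where
  "mixd n f q x = (\<Sum>j=0..n. fullp n q j * f j x)"

definition postp :: "nat \<Rightarrow> (nat \<Rightarrow> real \<Rightarrow> real) \<Rightarrow> (nat \<Rightarrow> real) \<Rightarrow> nat \<Rightarrow> real \<Rightarrow> real" where
  "postp n f q i x = q i * f i x / mixd n f q x"

definition LB_val :: "nat \<Rightarrow> real \<Rightarrow> real \<Rightarrow> (nat \<Rightarrow> real \<Rightarrow> real) \<Rightarrow> (nat \<Rightarrow> real)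
    \<Rightarrow> (nat \<Rightarrow> real) \<Rightarrow> (real \<Rightarrow> real) \<Rightarrow> real" where
  "LB_val n xl xu f q b C =
     (LINT x:{xl..xu}|lborel. C (\<Sum>i=1..n. b i * postp n f q i x) * mixd n f q x)"

definition LB_ge :: "nat \<Rightarrow> real \<Rightarrow> real \<Rightarrow> (nat \<Rightarrow> real \<Rightarrow> real)
    \<Rightarrow> real \<Rightarrow> real \<Rightarrow> (nat \<Rightarrow> real \<Rightarrow> real) \<Rightarrow> bool" where
  "LB_ge n xl xu f yl yu g \<longleftrightarrow>
     (\<forall>q\<in>tsimplex n. \<forall>b::nat \<Rightarrow> real. \<forall>C::real \<Rightarrow> real. convex_on UNIV C \<longrightarrow>
        LB_val n xl xu f q b C \<ge> LB_val n yl yu g q b C)"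

text \<open>Screening environment: alternatives {0..k}, prior q, finite type set P with
  distribution \<pi>, \<psi>, v2, and transfer bounds mlo < mhi (v1, u1 are unrestricted).\<close>
definition screening_env :: "nat \<Rightarrow> nat \<Rightarrow> (nat \<Rightarrow> real) \<Rightarrow> (nat \<Rightarrow> real) set
    \<Rightarrow> ((nat \<Rightarrow> real) \<Rightarrow> real) \<Rightarrow> (nat \<Rightarrow> real) \<Rightarrow> (real \<Rightarrow> real) \<Rightarrow> real \<Rightarrow> real \<Rightarrow> bool" where
  "screening_env n k q P \<pi> \<psi> v2 mlo mhi \<longleftrightarrow>
     q \<in> tsimplex n \<and> finite P \<and> P \<subseteq> tsimplex n \<and>
     (\<forall>p\<in>P. 0 \<le> \<pi> p) \<and> sum \<pi> P = 1 \<and>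
     (\<forall>i\<in>{1..n}. (\<Sum>p\<in>P. \<pi> p * p i) = q i) \<and>
     (\<forall>a\<in>{0..k}. 0 \<le> \<psi> a \<and> \<psi> a \<le> 1) \<and>
     continuous_on UNIV v2 \<and> convex_on UNIV v2 \<and> mlo < mhi"

text \<open>Expected transfer-and-outcome utility of agent of type p reporting p'.
  The transfer rule t takes the report, the alternative and Some x (signal x) or None (signal \<bottom>).\<close>
definition agentU :: "nat \<Rightarrow> real \<Rightarrow> real \<Rightarrow> (nat \<Rightarrow> real \<Rightarrow> real) \<Rightarrow> nat
    \<Rightarrow> (nat \<Rightarrow> real) \<Rightarrow> (nat \<Rightarrow> nat \<Rightarrow> real)
    \<Rightarrow> ((nat \<Rightarrow> real) \<Rightarrow> nat \<Rightarrow> real) \<Rightarrow> ((nat \<Rightarrow> real) \<Rightarrow> nat \<Rightarrow> real option \<Rightarrow> real)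
    \<Rightarrow> (nat \<Rightarrow> real) \<Rightarrow> (nat \<Rightarrow> real) \<Rightarrow> real" where
  "agentU n xl xu f k \<psi> u1 ah t p p' =
     (\<Sum>a=0..k. ah p' a * (\<Sum>i=0..n. fullp n p i *
        (u1 a i + \<psi> a * (LINT x:{xl..xu}|lborel. t p' a (Some x) * f i x)
                 + (1 - \<psi> a) * t p' a None)))"

definition principal_obj :: "nat \<Rightarrow> real \<Rightarrow> real \<Rightarrow> (nat \<Rightarrow> real \<Rightarrow> real) \<Rightarrow> nat
    \<Rightarrow> (nat \<Rightarrow> real) set \<Rightarrow> ((nat \<Rightarrow> real) \<Rightarrow> real) \<Rightarrow> (nat \<Rightarrow> real)
    \<Rightarrow> (nat \<Rightarrow> nat \<Rightarrow> real) \<Rightarrow> (real \<Rightarrow> real)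
    \<Rightarrow> ((nat \<Rightarrow> real) \<Rightarrow> nat \<Rightarrow> real) \<Rightarrow> ((nat \<Rightarrow> real) \<Rightarrow> nat \<Rightarrow> real option \<Rightarrow> real) \<Rightarrow> real" where
  "principal_obj n xl xu f k P \<pi> \<psi> v1 v2 ah t =
     (\<Sum>p\<in>P. \<pi> p * (\<Sum>a=0..k. ah p a * (\<Sum>i=0..n. fullp n p i *
        (v1 a i - (\<psi> a * (LINT x:{xl..xu}|lborel. v2 (t p a (Some x)) * f i x)
                   + (1 - \<psi> a) * v2 (t p a None))))))"

definition feasible :: "nat \<Rightarrow> real \<Rightarrow> real \<Rightarrow> (nat \<Rightarrow> real \<Rightarrow> real) \<Rightarrow> nat
    \<Rightarrow> (nat \<Rightarrow> real) set \<Rightarrow> (nat \<Rightarrow> real) \<Rightarrow> (nat \<Rightarrow> nat \<Rightarrow> real) \<Rightarrow> real \<Rightarrow> real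
    \<Rightarrow> ((nat \<Rightarrow> real) \<Rightarrow> nat \<Rightarrow> real) \<Rightarrow> ((nat \<Rightarrow> real) \<Rightarrow> nat \<Rightarrow> real option \<Rightarrow> real) \<Rightarrow> bool" where
  "feasible n xl xu f k P \<psi> u1 mlo mhi ah t \<longleftrightarrow>
     (\<forall>p\<in>P. (\<forall>a\<in>{0..k}. 0 \<le> ah p a) \<and> sum (ah p) {0..k} = 1) \<and>
     (\<forall>p\<in>P. \<forall>a\<in>{0..k}. set_borel_measurable lborel {xl..xu} (\<lambda>x. t p a (Some x)) \<and>
        (\<forall>x\<in>{xl..xu}. mlo \<le> t p a (Some x) \<and> t p a (Some x) \<le> mhi) \<and>
        mlo \<le> t p a None \<and> t p a None \<le> mhi) \<and>
     (\<forall>p\<in>P. agentU n xl xu f k \<psi> u1 ah t p p \<ge> 0) \<and>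
     (\<forall>p\<in>P. \<forall>p'\<in>P. agentU n xl xu f k \<psi> u1 ah t p p \<ge> agentU n xl xu f k \<psi> u1 ah t p p')"

text \<open>Value W (extended real; Sup of the empty set is -\<infinity>).\<close>
definition Wval :: "nat \<Rightarrow> real \<Rightarrow> real \<Rightarrow> (nat \<Rightarrow> real \<Rightarrow> real) \<Rightarrow> nat
    \<Rightarrow> (nat \<Rightarrow> real) set \<Rightarrow> ((nat \<Rightarrow> real) \<Rightarrow> real) \<Rightarrow> (nat \<Rightarrow> real)
    \<Rightarrow> (nat \<Rightarrow> nat \<Rightarrow> real) \<Rightarrow> (real \<Rightarrow> real) \<Rightarrow> (nat \<Rightarrow> nat \<Rightarrow> real) \<Rightarrow> real \<Rightarrow> real \<Rightarrow> ereal" where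
  "Wval n xl xu f k P \<pi> \<psi> v1 v2 u1 mlo mhi =
     (SUP m \<in> {(ah, t). feasible n xl xu f k P \<psi> u1 mlo mhi ah t}.
        ereal (principal_obj n xl xu f k P \<pi> \<psi> v1 v2 (fst m) (snd m)))"

end

theory Submission
  imports Defs
begin

text \<open>Both conditions are equivalent to the inclusion of zonotopes, expressed by support functions:
  \<integral> \<bar>\<Sum> e i * g i\<bar> \<le> \<integral> \<bar>\<Sum> e i * f i\<bar> for every coefficient vector e.

  If F dominates G, a transfer rule under G is replaced, separately for each report and alternative,
  by one under F with the same expected transfer in every state and no larger expected cost. To find
  it, minimise the squared distance to these requirements over all transfer rules; a minimiser exists
  because nearly optimal rules of nearly least L2-norm form a Cauchy sequence. If the minimum were
  positive, the minimiser would give a linear functional of (expected transfers, cost) separating the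
  target from everything attainable under F. Minimising this functional pointwise turns the
  separation into a comparison of integrals of a homogeneous convex function of two linear
  combinations of the densities, which contradicts the LB order.

  Conversely, let e violate the inequality, and consider two types with beliefs proportional to the
  positive and the negative part of e. Under G both are paid sgn (\<Sum> e i * g i), with the
  participation constraint of the first type binding. Under F the second type can mimic the first,
  and the first type's participation constraint then makes the pair strictly more expensive.
  A convex C is uniformly close to a combination of affine functions and functions
  \<bar>s - c\<bar> with nonnegative weights, which gives the LB order.\<close>

subsection \<open>Attained minima over bounded measurable functions\<close>

text \<open>The bounds hold at every point, not almost everywhere. All values of a rule thus lie in
  one compact interval, on which a continuous cost function is bounded, and limits can be repaired
  by clipping.\<close>

definition rules :: "'a measure \<Rightarrow> real \<Rightarrow> real \<Rightarrow> ('a \<Rightarrow> real) set" where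
  "rules M lo hi = {t \<in> borel_measurable M. \<forall>x. lo \<le> t x \<and> t x \<le> hi}"

lemma rulesD:
  assumes "t \<in> rules M lo hi"
  shows "t \<in> borel_measurable M" "lo \<le> t x" "t x \<le> hi" "\<bar>t x\<bar> \<le> max \<bar>lo\<bar> \<bar>hi\<bar>"
  using assms by (auto simp: rules_def max_def abs_le_iff intro: order_trans)
    (smt (verit))+

lemma integrable_bounded_mult:
  fixes h w :: "'a \<Rightarrow> real"
  assumes w: "integrable M w" and h: "h \<in> borel_measurable M" and b: "\<And>x. \<bar>h x\<bar> \<le> K"
  shows "integrable M (\<lambda>x. h x * w x)"
proof (rule Bochner_Integration.integrable_bound[where f = "\<lambda>x. K * w x"])
  show "integrable M (\<lambda>x. K * w x)" using w by simp
  show "(\<lambda>x. h x * w x) \<in> borel_measurable M" using h w by measurable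
  have "\<bar>h x\<bar> * \<bar>w x\<bar> \<le> \<bar>K\<bar> * \<bar>w x\<bar>" for x
    using b[of x] by (intro mult_right_mono) auto
  then show "AE x in M. norm (h x * w x) \<le> norm (K * w x)"
    by (simp add: abs_mult)
qed

text \<open>Tonelli: the integral of the sum is the finite sum of the integrals, and a function with
  finite integral is finite almost everywhere.\<close>

lemma AE_summable_if_integrals_summable:
  fixes h :: "nat \<Rightarrow> 'a \<Rightarrow> real"
  assumes int: "\<And>j. integrable M (h j)" and nonneg: "\<And>j x. 0 \<le> h j x"
    and s: "summable (\<lambda>j. \<integral>x. h j x \<partial>M)"
  shows "AE x in M. summable (\<lambda>j. h j x)"
proof -
  have m: "(\<lambda>x. ennreal (h j x)) \<in> borel_measurable M" for j
    using borel_measurable_integrable[OF int[of j]] by measurable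
  have "(\<integral>\<^sup>+x. (\<Sum>j. ennreal (h j x)) \<partial>M) = (\<Sum>j. \<integral>\<^sup>+x. ennreal (h j x) \<partial>M)"
    using m by (rule nn_integral_suminf)
  also have "\<dots> = (\<Sum>j. ennreal (\<integral>x. h j x \<partial>M))"
    by (intro suminf_cong nn_integral_eq_integral int) (auto simp: nonneg)
  also have "\<dots> = ennreal (\<Sum>j. \<integral>x. h j x \<partial>M)"
    by (intro suminf_ennreal2 s Bochner_Integration.integral_nonneg nonneg)
  also have "\<dots> \<noteq> \<infinity>" by simp
  finally have "AE x in M. (\<Sum>j. ennreal (h j x)) \<noteq> \<infinity>"
    by (intro nn_integral_PInf_AE) (use m in measurable)
  then show ?thesis
    by eventually_elim (auto intro!: summable_suminf_not_top nonneg)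
qed

text \<open>A direct method in which the parallelogram law replaces weak compactness. By
  \<open>mid\<close> the near-optimal sets \<open>D e\<close> are closed under midpoints. Their
  least squared norms \<open>A e\<close> do not decrease as \<open>e\<close> shrinks and have a
  finite supremum \<open>Ab\<close>, so near-optimal rules of nearly least norm lie close together.
  Their almost everywhere limit attains the infimum by \<open>cont\<close>.\<close>

lemma rules_attains_min:
  fixes w :: "'a \<Rightarrow> real" and J :: "('a \<Rightarrow> real) \<Rightarrow> real"
  assumes w: "integrable M w" "\<And>x. 0 \<le> w x" and lohi: "lo \<le> hi"
    and J0: "\<And>t. 0 \<le> J t"
    and mid: "\<And>s t. s \<in> rules M lo hi \<Longrightarrow> t \<in> rules M lo hi \<Longrightarrow>
                J (\<lambda>x. (s x + t x) / 2) \<le> max (J s) (J t)"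
    and cont: "\<And>u t. (\<And>k::nat. u k \<in> rules M lo hi) \<Longrightarrow> t \<in> rules M lo hi \<Longrightarrow>
                (AE x in M. w x \<noteq> 0 \<longrightarrow> (\<lambda>k. u k x) \<longlonglongrightarrow> t x) \<Longrightarrow> (\<lambda>k. J (u k)) \<longlonglongrightarrow> J t"
  shows "\<exists>t\<in>rules M lo hi. \<forall>s\<in>rules M lo hi. J t \<le> J s"
proof -
  let ?T = "rules M lo hi"
  define K where "K = max \<bar>lo\<bar> \<bar>hi\<bar>"
  define Q where "Q t = (\<integral>x. (t x)\<^sup>2 * w x \<partial>M)" for t
  define d where "d = (INF t\<in>?T. J t)"
  define D where "D e = {t\<in>?T. J t \<le> d + e}" for e
  define A where "A e = (INF t\<in>D e. Q t)" for e
  define Ab where "Ab = (SUP e\<in>{0<..}. A e)"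
  have Tne: "(\<lambda>_. lo) \<in> ?T" using lohi by (simp add: rules_def)
  have bddJ: "bdd_below (J ` ?T)" using J0 by (intro bdd_belowI2[where m = 0])
  have dle: "d \<le> J t" if "t \<in> ?T" for t
    unfolding d_def using bddJ that by (rule cINF_lower)
  have Dne: "D e \<noteq> {}" if "0 < e" for e
  proof -
    have "\<exists>t\<in>?T. J t < d + e"
      using cINF_less_iff[of ?T J "d + e"] bddJ Tne that unfolding d_def by fastforce
    then show ?thesis by (auto simp: D_def intro: less_imp_le)
  qed
  have Dmono: "D e \<subseteq> D e'" if "e \<le> e'" for e e' using that by (auto simp: D_def)
  have sqb: "\<bar>(t x)\<^sup>2\<bar> \<le> K\<^sup>2" if "t \<in> ?T" for t x
  proof -
    have "\<bar>t x\<bar> \<le> \<bar>K\<bar>" using rulesD(4)[OF that, of x] by (simp add: K_def)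
    then show ?thesis by (simp add: abs_le_square_iff)
  qed
  have Qint: "integrable M (\<lambda>x. (t x)\<^sup>2 * w x)" if "t \<in> ?T" for t
    by (rule integrable_bounded_mult[OF w(1) _ sqb[OF that]]) (use rulesD(1)[OF that] in measurable)
  have Q0: "0 \<le> Q t" for t unfolding Q_def using w(2) by (simp add: integral_nonneg_AE)
  have QB: "Q t \<le> (\<integral>x. K\<^sup>2 * w x \<partial>M)" if "t \<in> ?T" for t
    unfolding Q_def
    by (intro integral_mono Qint that integrable_mult_right w(1) mult_right_mono w(2))
       (use sqb[OF that] in auto)
  define B where "B = (\<integral>x. K\<^sup>2 * w x \<partial>M)"
  have bddQ: "bdd_below (Q ` D e)" for e using Q0 by (intro bdd_belowI2[where m = 0])
  have AleQ: "A e \<le> Q t" if "t \<in> D e" for e t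
    unfolding A_def using bddQ that by (rule cINF_lower)
  have AB: "A e \<le> B" if e0: "0 < e" for e
  proof -
    obtain t where t: "t \<in> D e" using Dne[OF e0] by blast
    then show ?thesis using AleQ[OF t] QB[of t] by (simp add: B_def D_def)
  qed
  have bddA: "bdd_above (A ` {0<..})" using AB by (auto intro!: bdd_aboveI)
  have Aanti: "A e' \<le> A e" if "0 < e" "e \<le> e'" for e e'
    unfolding A_def by (rule cINF_superset_mono[OF Dne[OF that(1)] bddQ Dmono[OF that(2)]]) auto
  have AleAb: "A e \<le> Ab" if "0 < e" for e
    unfolding Ab_def using bddA that by (intro cSUP_upper) auto
  \<comment> \<open>Scaled so that the parallelogram estimate below, with bound
    \<open>8 * eta j\<close>, becomes \<open>(1/4)^j\<close>.\<close>
  define eta where "eta j = (1/4)^j / (8::real)" for j :: nat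
  have eta0: "0 < eta j" for j by (simp add: eta_def)
  have eta_anti: "eta (Suc j) \<le> eta j" for j by (simp add: eta_def)
  \<comment> \<open>A suitable \<open>e\<close> exists because \<open>Ab\<close> is a supremum and
    shrinking \<open>e\<close> can only raise \<open>A e\<close>; then \<open>A e \<le> Ab\<close>
    leaves room for \<open>t\<close>.\<close>
  have "\<exists>e t. 0 < e \<and> e \<le> (1/2)^j \<and> A e > Ab - eta j \<and> t \<in> D e \<and> Q t < Ab + eta j" for j
  proof -
    have "\<exists>e\<in>{0<..}. Ab - eta j < A e"
      using less_cSUP_iff[of "{0<..}" A "Ab - eta j"] bddA eta0[of j] unfolding Ab_def
      by (auto simp: Ab_def)
    then obtain e0 where e0: "0 < e0" "Ab - eta j < A e0" by auto
    define e where "e = min e0 ((1/2)^j)"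
    have e: "0 < e" "e \<le> (1/2)^j" "e \<le> e0" using e0 by (auto simp: e_def)
    have Ae: "A e > Ab - eta j" using Aanti[OF e(1,3)] e0 by simp
    have "(INF t\<in>D e. Q t) < Ab + eta j"
      using AleAb[OF e(1)] eta0[of j] by (simp add: A_def)
    then have "\<exists>t\<in>D e. Q t < Ab + eta j"
      using cINF_less_iff[of "D e" Q] Dne[OF e(1)] bddQ by auto
    then show ?thesis using e Ae by blast
  qed
  then obtain e u where eu: "\<And>j. 0 < e j" "\<And>j. e j \<le> (1/2)^j" "\<And>j. A (e j) > Ab - eta j"
    "\<And>j. u j \<in> D (e j)" "\<And>j. Q (u j) < Ab + eta j" by metis
  have uT: "u j \<in> ?T" for j using eu(4)[of j] by (simp add: D_def)
  have um: "u j \<in> borel_measurable M" for j using rulesD(1)[OF uT] .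
  have diffb: "\<bar>u (Suc j) x - u j x\<bar> \<le> 2 * K" for j x
    using rulesD(4)[OF uT, of j x] rulesD(4)[OF uT, of "Suc j" x] unfolding K_def by linarith
  have dint2: "integrable M (\<lambda>x. (u (Suc j) x - u j x)\<^sup>2 * w x)" for j
  proof (rule integrable_bounded_mult[OF w(1), where K = "(2*K)\<^sup>2"])
    show "(\<lambda>x. (u (Suc j) x - u j x)\<^sup>2) \<in> borel_measurable M" using um by measurable
    show "\<bar>(u (Suc j) x - u j x)\<^sup>2\<bar> \<le> (2*K)\<^sup>2" for x
      using diffb[of j x] by (metis abs_ge_zero abs_power2 power2_abs power_mono)
  qed
  have dint: "integrable M (\<lambda>x. \<bar>u (Suc j) x - u j x\<bar> * w x)" for j
    by (rule integrable_bounded_mult[OF w(1), where K = "2*K"]) (use um diffb in \<open>measurable, auto\<close>)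
  have dQ: "(\<integral>x. (u (Suc j) x - u j x)\<^sup>2 * w x \<partial>M) \<le> (1/4)^j" for j
  proof -
    let ?m = "\<lambda>x. (u j x + u (Suc j) x) / 2"
    \<comment> \<open>Both rules lie in the larger of their two near-optimal sets, hence so does
      their midpoint; \<open>em\<close> is one of the two levels, so its least norm is still above
      \<open>Ab - eta j\<close>.\<close>
    define em where "em = max (e j) (e (Suc j))"
    have mT: "?m \<in> ?T"
    proof -
      have "lo \<le> ?m x \<and> ?m x \<le> hi" for x
        using rulesD(2,3)[OF uT, of j x] rulesD(2,3)[OF uT, of "Suc j" x] by auto
      then show ?thesis unfolding rules_def using um by (auto intro!: borel_measurable_divide borel_measurable_add)
    qed
    have "u j \<in> D em" "u (Suc j) \<in> D em"
      using eu(4)[of j] eu(4)[of "Suc j"] Dmono[of "e j" em] Dmono[of "e (Suc j)" em] by (auto simp: em_def)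
    then have "?m \<in> D em" using mid[OF uT[of j] uT[of "Suc j"]] mT by (auto simp: D_def)
    then have "A em \<le> Q ?m" by (rule AleQ)
    moreover have "A em > Ab - eta j"
      using eu(3)[of j] eu(3)[of "Suc j"] eta_anti[of j] unfolding em_def max_def by auto
    ultimately have m: "Q ?m > Ab - eta j" by simp
    \<comment> \<open>Parallelogram identity: both squared norms are below
      \<open>Ab + eta j\<close>, while that of the midpoint exceeds
      \<open>Ab - eta j\<close>.\<close>
    have "(\<integral>x. (u (Suc j) x - u j x)\<^sup>2 * w x \<partial>M)
        = (\<integral>x. (2 * ((u (Suc j) x)\<^sup>2 * w x) + 2 * ((u j x)\<^sup>2 * w x)) - 4 * ((?m x)\<^sup>2 * w x) \<partial>M)"
      by (rule Bochner_Integration.integral_cong) (auto simp: field_simps power2_eq_square)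
    also have "\<dots> = 2 * Q (u (Suc j)) + 2 * Q (u j) - 4 * Q ?m"
      unfolding Q_def using Qint[OF uT[of j]] Qint[OF uT[of "Suc j"]] Qint[OF mT] by simp
    also have "\<dots> \<le> 8 * eta j"
      using m eu(5)[of j] eu(5)[of "Suc j"] eta_anti[of j] by linarith
    finally show ?thesis by (simp add: eta_def)
  qed
  define W where "W = (\<integral>x. w x \<partial>M)"
  have dL1: "(\<integral>x. \<bar>u (Suc j) x - u j x\<bar> * w x \<partial>M) \<le> ((1/2)^j) * (W + 1)" for j
  proof -
    \<comment> \<open>Trades the squared bound \<open>(1/4)^j\<close> for a bound on the absolute
      difference: both terms contribute order \<open>(1/2)^j\<close>, which is summable.\<close>
    have am: "\<bar>y\<bar> \<le> (1/2)^j + 2^j * y\<^sup>2" for y :: real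
    proof (cases "\<bar>y\<bar> \<le> (1/2)^j")
      case True
      then show ?thesis by (simp add: add_increasing2)
    next
      case False
      then have "1 \<le> 2^j * \<bar>y\<bar>" by (simp add: field_simps)
      then have "\<bar>y\<bar> * 1 \<le> \<bar>y\<bar> * (2^j * \<bar>y\<bar>)" by (intro mult_left_mono) auto
      then have "\<bar>y\<bar> \<le> 2^j * y\<^sup>2" by (simp add: power2_eq_square algebra_simps abs_mult_self_eq)
      moreover have "0 \<le> (1/2::real)^j" by simp
      ultimately show ?thesis by linarith
    qed
    have "(\<integral>x. \<bar>u (Suc j) x - u j x\<bar> * w x \<partial>M)
        \<le> (\<integral>x. (1/2)^j * w x + 2^j * ((u (Suc j) x - u j x)\<^sup>2 * w x) \<partial>M)"
    proof (intro integral_mono dint Bochner_Integration.integrable_add integrable_mult_right w(1) dint2)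
      fix x
      show "\<bar>u (Suc j) x - u j x\<bar> * w x \<le> (1/2)^j * w x + 2^j * ((u (Suc j) x - u j x)\<^sup>2 * w x)"
        using mult_right_mono[OF am[of "u (Suc j) x - u j x"] w(2)[of x]] by (simp add: algebra_simps)
    qed
    also have "\<dots> = (1/2)^j * W + 2^j * (\<integral>x. (u (Suc j) x - u j x)\<^sup>2 * w x \<partial>M)"
      using w(1) dint2[of j] by (simp add: W_def)
    also have "\<dots> \<le> (1/2)^j * W + 2^j * (1/4)^j"
      using dQ[of j] by simp
    also have "(2::real)^j * (1/4)^j = (1/2)^j" by (simp add: power_mult_distrib[symmetric])
    finally show ?thesis by (simp add: algebra_simps)
  qed
  have "AE x in M. summable (\<lambda>j. \<bar>u (Suc j) x - u j x\<bar> * w x)"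
  proof (rule AE_summable_if_integrals_summable[OF dint])
    show "0 \<le> \<bar>u (Suc j) x - u j x\<bar> * w x" for j x using w(2) by simp
    have "summable (\<lambda>j. ((1/2)^j) * (W + 1))"
      by (intro summable_mult2) (simp add: summable_geometric_iff)
    then show "summable (\<lambda>j. \<integral>x. \<bar>u (Suc j) x - u j x\<bar> * w x \<partial>M)"
      by (rule summable_comparison_test') (use dL1 w(2) in \<open>simp add: integral_nonneg_AE\<close>)
  qed
  then have conv: "AE x in M. w x \<noteq> 0 \<longrightarrow> convergent (\<lambda>j. u j x)"
  proof eventually_elim
    case (elim x)
    show ?case
    proof
      assume "w x \<noteq> 0"
      then have "summable (\<lambda>j. \<bar>u (Suc j) x - u j x\<bar>)" using summable_cmult_iff[of "w x"] elim
        by (simp add: mult.commute)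
      then have "summable (\<lambda>j. u (Suc j) x - u j x)" by (rule summable_rabs_cancel)
      then have "convergent (\<lambda>N. \<Sum>j<N. (u (Suc j) x - u j x))" by (simp add: summable_iff_convergent)
      then have "convergent (\<lambda>N. u N x - u 0 x)" by (simp only: sum_lessThan_telescope[where f = "\<lambda>j. u j x"])
      then show "convergent (\<lambda>j. u j x)" using convergent_add_const_right_iff[of "\<lambda>N. u N x" "- u 0 x"] by simp
    qed
  qed
  \<comment> \<open>Clipping keeps \<open>t\<close> within the bounds also where the sequence
    diverges and \<open>lim\<close> is arbitrary.\<close>
  define t where "t x = max lo (min hi (lim (\<lambda>j. u j x)))" for x
  have tT: "t \<in> ?T"
    unfolding rules_def t_def using lohi um by (auto intro!: borel_measurable_max borel_measurable_min borel_measurable_lim_metric)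
  have "AE x in M. w x \<noteq> 0 \<longrightarrow> (\<lambda>k. u k x) \<longlonglongrightarrow> t x"
    using conv
  proof eventually_elim
    case (elim x)
    show ?case
    proof
      assume "w x \<noteq> 0"
      then have l: "(\<lambda>j. u j x) \<longlonglongrightarrow> lim (\<lambda>j. u j x)" using elim by (simp add: convergent_LIMSEQ_iff)
      have "lo \<le> lim (\<lambda>j. u j x)" "lim (\<lambda>j. u j x) \<le> hi"
        using LIMSEQ_le_const[OF l] LIMSEQ_le_const2[OF l] rulesD(2,3)[OF uT] by blast+
      then show "(\<lambda>k. u k x) \<longlonglongrightarrow> t x" using l by (simp add: t_def)
    qed
  qed
  then have lim: "(\<lambda>k. J (u k)) \<longlonglongrightarrow> J t" by (intro cont uT tT)
  have "(\<lambda>k. d + (1/2)^k) \<longlonglongrightarrow> d + 0" by (intro tendsto_intros LIMSEQ_realpow_zero) auto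
  moreover have "J (u k) \<le> d + (1/2)^k" for k using eu(4)[of k] eu(2)[of k] by (simp add: D_def)
  ultimately have "J t \<le> d" using LIMSEQ_le[OF lim] by force
  then show ?thesis using tT dle by force
qed

subsection \<open>Transfer rules with prescribed expectations\<close>

lemma continuous_bounded_on_interval:
  fixes v :: "real \<Rightarrow> real"
  assumes "continuous_on UNIV v"
  obtains K where "\<And>y. lo \<le> y \<Longrightarrow> y \<le> hi \<Longrightarrow> \<bar>v y\<bar> \<le> K"
proof -
  have "bounded (v ` {lo..hi})"
    by (intro compact_imp_bounded compact_continuous_image continuous_on_subset[OF assms]) auto
  then obtain K where "\<forall>y\<in>v ` {lo..hi}. norm y \<le> K" unfolding bounded_iff by blast
  then show ?thesis by (intro that[of K]) auto
qed

lemma rules_integrable: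
  fixes v :: "real \<Rightarrow> real"
  assumes t: "t \<in> rules M lo hi" and v: "continuous_on UNIV v" and F: "integrable M F"
  shows "integrable M (\<lambda>x. v (t x) * F x)"
proof -
  obtain K where K: "\<And>y. lo \<le> y \<Longrightarrow> y \<le> hi \<Longrightarrow> \<bar>v y\<bar> \<le> K"
    using continuous_bounded_on_interval[OF v] by metis
  show ?thesis
    by (rule integrable_bounded_mult[OF F, where K = K])
      (use borel_measurable_continuous_on[OF v rulesD(1)[OF t]] K rulesD(2,3)[OF t] in auto)
qed

text \<open>Dominated convergence, with a bound of \<open>v\<close> on \<open>{lo..hi}\<close> times
  \<open>\<bar>F x\<bar>\<close>. Where \<open>F\<close> vanishes the integrands are 0, so
  convergence is asked only elsewhere.\<close>

lemma rules_integral_tendsto: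
  fixes v :: "real \<Rightarrow> real"
  assumes u: "\<And>k::nat. u k \<in> rules M lo hi" and t: "t \<in> rules M lo hi"
    and v: "continuous_on UNIV v" and F: "integrable M F"
    and conv: "AE x in M. F x \<noteq> 0 \<longrightarrow> (\<lambda>k. u k x) \<longlonglongrightarrow> t x"
  shows "(\<lambda>k. \<integral>x. v (u k x) * F x \<partial>M) \<longlonglongrightarrow> (\<integral>x. v (t x) * F x \<partial>M)"
proof -
  obtain K where K: "\<And>y. lo \<le> y \<Longrightarrow> y \<le> hi \<Longrightarrow> \<bar>v y\<bar> \<le> K"
    using continuous_bounded_on_interval[OF v] by metis
  show ?thesis
  proof (rule integral_dominated_convergence[where w = "\<lambda>x. K * \<bar>F x\<bar>"])
    show "(\<lambda>x. v (t x) * F x) \<in> borel_measurable M"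
      using rules_integrable[OF t v F] by auto
    show "(\<lambda>x. v (u k x) * F x) \<in> borel_measurable M" for k
      using rules_integrable[OF u v F] by auto
    show "integrable M (\<lambda>x. K * \<bar>F x\<bar>)" using F by auto
    show "AE x in M. (\<lambda>k. v (u k x) * F x) \<longlonglongrightarrow> v (t x) * F x"
      using conv
    proof eventually_elim
      case (elim x)
      show ?case
      proof (cases "F x = 0")
        case False
        have "isCont v (t x)" using v by (simp add: continuous_on_eq_continuous_at)
        then have "(\<lambda>k. v (u k x)) \<longlonglongrightarrow> v (t x)"
          using elim False by (intro isCont_tendsto_compose[where g = v]) auto
        then show ?thesis by (rule tendsto_mult_right)
      qed simp
    qed
    show "AE x in M. norm (v (u k x) * F x) \<le> K * \<bar>F x\<bar>" for k
      using K rulesD(2,3)[OF u] by (auto simp: abs_mult intro!: mult_right_mono)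
  qed
qed

text \<open>By induction on \<open>T\<close>, the selection switches to the new level wherever that
  level reaches the old maximum. The levels are real numbers, so that a selection can serve as a
  transfer rule.\<close>

lemma Max_selection:
  fixes h :: "real \<Rightarrow> 'a \<Rightarrow> real"
  assumes "finite T" "T \<noteq> {}" "\<And>\<tau>. \<tau> \<in> T \<Longrightarrow> h \<tau> \<in> borel_measurable M"
  shows "(\<lambda>x. Max ((\<lambda>\<tau>. h \<tau> x) ` T)) \<in> borel_measurable M \<and>
    (\<exists>\<sigma>\<in>borel_measurable M. \<forall>x. \<sigma> x \<in> T \<and> Max ((\<lambda>\<tau>. h \<tau> x) ` T) = h (\<sigma> x) x)"
  using assms
proof (induction T rule: finite_ne_induct)
  case (singleton \<tau>)
  then show ?case by (auto intro!: bexI[where x = "\<lambda>_. \<tau>"])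
next
  case (insert \<tau> T)
  let ?m = "\<lambda>x. Max ((\<lambda>\<tau>. h \<tau> x) ` T)"
  have [measurable]: "?m \<in> borel_measurable M" "h \<tau> \<in> borel_measurable M" using insert by auto
  obtain \<sigma> where [measurable]: "\<sigma> \<in> borel_measurable M"
    and \<sigma>: "\<And>x. \<sigma> x \<in> T" "\<And>x. ?m x = h (\<sigma> x) x" using insert by auto
  have eq: "Max ((\<lambda>\<tau>. h \<tau> x) ` insert \<tau> T) = max (h \<tau> x) (?m x)" for x
    using insert by simp
  define \<sigma>' where "\<sigma>' x = (if ?m x \<le> h \<tau> x then \<tau> else \<sigma> x)" for x
  have "\<sigma>' \<in> borel_measurable M" unfolding \<sigma>'_def by measurable
  moreover have "\<sigma>' x \<in> insert \<tau> T \<and> max (h \<tau> x) (?m x) = h (\<sigma>' x) x" for x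
    using \<sigma>[of x] by (auto simp: \<sigma>'_def)
  moreover have "(\<lambda>x. max (h \<tau> x) (?m x)) \<in> borel_measurable M" by measurable
  ultimately show ?case unfolding eq by blast
qed

text \<open>Let \<open>\<theta>\<close> tend to 0. This serves both for a first-order condition and
  for a perturbation of the prior.\<close>

lemma nonpos_if_le_small_multiples:
  fixes x y :: real
  assumes "\<And>\<theta>. 0 < \<theta> \<Longrightarrow> \<theta> < 1 \<Longrightarrow> x \<le> \<theta> * y"
  shows "x \<le> 0"
proof (rule ccontr)
  assume "\<not> x \<le> 0"
  then have x: "0 < x" by simp
  define \<theta> where "\<theta> = x / (x + \<bar>y\<bar> + 1)"
  have "0 < \<theta>" "\<theta> < 1" using x by (auto simp: \<theta>_def field_simps)
  then have "x \<le> \<theta> * y" by (rule assms)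
  also have "\<dots> \<le> \<theta> * \<bar>y\<bar>" using \<open>0 < \<theta>\<close> by (intro mult_left_mono) auto
  also have "\<dots> < x"
  proof -
    have "x * \<bar>y\<bar> < x * (x + \<bar>y\<bar> + 1)" using x by (intro mult_strict_left_mono) auto
    then show ?thesis unfolding \<theta>_def using x by (simp add: divide_less_eq)
  qed
  finally show False by simp
qed

text \<open>The integrand expresses, point by point in the transfer, the negative of a linear
  functional of expected transfers and expected cost. The sign turns minimisation over levels into
  the finite maxima compared by the LB order.\<close>

lemma rules_linear_integral:
  fixes F :: "'i \<Rightarrow> 'a \<Rightarrow> real"
  assumes "finite I" and F: "\<And>i. i \<in> I \<Longrightarrow> integrable M (F i)"
    and t: "t \<in> rules M lo hi" and v: "continuous_on UNIV v"
  shows "integrable M (\<lambda>x. - t x * (\<Sum>i\<in>I. \<alpha> i * F i x) + - \<beta> * v (t x) * (\<Sum>i\<in>I. r i * F i x))" (is ?int)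
    and "(\<integral>x. - t x * (\<Sum>i\<in>I. \<alpha> i * F i x) + - \<beta> * v (t x) * (\<Sum>i\<in>I. r i * F i x) \<partial>M)
      = - ((\<Sum>i\<in>I. \<alpha> i * (\<integral>x. t x * F i x \<partial>M)) + \<beta> * (\<integral>x. v (t x) * (\<Sum>i\<in>I. r i * F i x) \<partial>M))" (is ?eq)
proof -
  have a: "integrable M (\<lambda>x. t x * F i x)" if "i \<in> I" for i
    using rules_integrable[OF t continuous_on_id F[OF that]] by simp
  have b: "integrable M (\<lambda>x. v (t x) * (\<Sum>i\<in>I. r i * F i x))"
    by (intro rules_integrable[OF t v] Bochner_Integration.integrable_sum integrable_mult_right F)
  have c: "integrable M (\<lambda>x. \<Sum>i\<in>I. \<alpha> i * (t x * F i x))"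
    by (intro Bochner_Integration.integrable_sum integrable_mult_right a)
  have eq: "(\<lambda>x. - t x * (\<Sum>i\<in>I. \<alpha> i * F i x) + - \<beta> * v (t x) * (\<Sum>i\<in>I. r i * F i x))
    = (\<lambda>x. - ((\<Sum>i\<in>I. \<alpha> i * (t x * F i x)) + \<beta> * (v (t x) * (\<Sum>i\<in>I. r i * F i x))))"
    by (auto simp: fun_eq_iff sum_distrib_left sum_negf mult_ac)
  show ?int unfolding eq using b c by simp
  have "(\<integral>x. (\<Sum>i\<in>I. \<alpha> i * (t x * F i x)) \<partial>M) = (\<Sum>i\<in>I. \<alpha> i * (\<integral>x. t x * F i x \<partial>M))"
    using a by (simp add: Bochner_Integration.integral_sum)
  then show ?eq unfolding eq using b c by simp
qed

text \<open>The LB order will be applied to finite sets of transfer levels, so a rule is first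
  approximated by rules with finite range.\<close>

lemma rules_discretization:
  assumes s: "s \<in> rules M lo hi"
  obtains u where "\<And>k::nat. u k \<in> rules M lo hi" "\<And>k. finite (range (u k))" "\<And>x. (\<lambda>k. u k x) \<longlonglongrightarrow> s x"
proof -
  \<comment> \<open>Values are rounded down to multiples of \<open>1 / real (Suc k)\<close>; the
    maximum with \<open>lo\<close> corrects rounding that would leave the interval.\<close>
  define u where "u k x = max lo (real_of_int \<lfloor>real (Suc k) * s x\<rfloor> / real (Suc k))" for k :: nat and x
  have le: "real_of_int \<lfloor>real (Suc k) * s x\<rfloor> / real (Suc k) \<le> s x" for k x
    by (simp add: divide_le_eq mult.commute del: of_nat_Suc)
  have ge: "s x - 1 / real (Suc k) \<le> real_of_int \<lfloor>real (Suc k) * s x\<rfloor> / real (Suc k)" for k x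
  proof -
    have "real (Suc k) * s x - 1 \<le> real_of_int \<lfloor>real (Suc k) * s x\<rfloor>" by linarith
    from divide_right_mono[OF this, of "real (Suc k)"] show ?thesis
      by (simp add: diff_divide_distrib del: of_nat_Suc)
  qed
  have u_le: "u k x \<le> s x" and u_ge: "s x - 1 / real (Suc k) \<le> u k x" for k x
    using le[of k x] ge[of x k] rulesD(2)[OF s, of x] unfolding u_def by linarith+
  have "u k \<in> rules M lo hi" for k
  proof -
    have "u k \<in> borel_measurable M" unfolding u_def using rulesD(1)[OF s] by measurable
    moreover have "lo \<le> u k x \<and> u k x \<le> hi" for x
      using u_le[of k x] rulesD(3)[OF s, of x] by (simp add: u_def)
    ultimately show ?thesis by (simp add: rules_def)
  qed
  moreover have "finite (range (u k))" for k
  proof (rule finite_subset)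
    show "range (u k) \<subseteq> (\<lambda>j::int. max lo (real_of_int j / real (Suc k))) `
        {\<lfloor>real (Suc k) * lo\<rfloor> .. \<lfloor>real (Suc k) * hi\<rfloor>}"
      unfolding u_def using rulesD(2,3)[OF s] by (auto intro!: image_eqI[OF refl] floor_mono mult_left_mono simp del: of_nat_Suc)
  qed simp
  moreover have "(\<lambda>k. u k x) \<longlonglongrightarrow> s x" for x
  proof (rule tendsto_sandwich)
    have "(\<lambda>k. s x - 1 / real (Suc k)) \<longlonglongrightarrow> s x - 0"
      by (intro tendsto_intros LIMSEQ_Suc[OF lim_1_over_n])
    then show "(\<lambda>k. s x - 1 / real (Suc k)) \<longlonglongrightarrow> s x" by simp
  qed (use u_le u_ge in auto)
  ultimately show ?thesis by (rule that)
qed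

text \<open>\<open>J\<close> is the squared distance of a rule's expected transfers and cost from
  the target, where only excess cost counts. At a minimiser \<open>t0\<close> the residuals
  \<open>\<alpha>\<close>, \<open>\<beta>\<close> define a linear functional that on every rule
  under \<open>F\<close> exceeds its value at the target by at least \<open>d = J t0\<close>. By
  \<open>H\<close>, discretisations of \<open>s\<close> exceed that value by \<open>d\<close> as
  well, yet they converge to the target; hence \<open>d \<le> 0\<close> and all residuals
  vanish.\<close>

lemma rule_transfer:
  fixes F :: "'i \<Rightarrow> 'a \<Rightarrow> real" and G :: "'i \<Rightarrow> 'b \<Rightarrow> real"
  assumes I: "finite I"
    and F: "\<And>i. i \<in> I \<Longrightarrow> integrable M (F i)" "\<And>i x. i \<in> I \<Longrightarrow> 0 \<le> F i x"
    and G: "\<And>i. i \<in> I \<Longrightarrow> integrable N (G i)"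
    and r: "\<And>i. i \<in> I \<Longrightarrow> 0 \<le> r i"
    and lohi: "lo \<le> hi" and v: "continuous_on UNIV v" "convex_on UNIV v"
    and H: "\<And>T a b c. finite T \<Longrightarrow> T \<noteq> {} \<Longrightarrow>
       (\<integral>y. Max ((\<lambda>\<tau>. a \<tau> * (\<Sum>i\<in>I. c i * G i y) + b \<tau> * (\<Sum>i\<in>I. r i * G i y)) ` T) \<partial>N)
       \<le> (\<integral>x. Max ((\<lambda>\<tau>::real. a \<tau> * (\<Sum>i\<in>I. c i * F i x) + b \<tau> * (\<Sum>i\<in>I. r i * F i x)) ` T) \<partial>M)"
    and s: "s \<in> rules N lo hi"
  shows "\<exists>t\<in>rules M lo hi. (\<forall>i\<in>I. (\<integral>x. t x * F i x \<partial>M) = (\<integral>y. s y * G i y \<partial>N)) \<and>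
     (\<integral>x. v (t x) * (\<Sum>i\<in>I. r i * F i x) \<partial>M) \<le> (\<integral>y. v (s y) * (\<Sum>i\<in>I. r i * G i y) \<partial>N)"
proof -
  let ?T = "rules M lo hi"
  define w where "w x = (\<Sum>i\<in>I. F i x)" for x
  define R where "R x = (\<Sum>i\<in>I. r i * F i x)" for x
  define m where "m t i = (\<integral>x. t x * F i x \<partial>M)" for t i
  define V where "V t = (\<integral>x. v (t x) * R x \<partial>M)" for t
  define z where "z i = (\<integral>y. s y * G i y \<partial>N)" for i
  define c where "c = (\<integral>y. v (s y) * (\<Sum>i\<in>I. r i * G i y) \<partial>N)"
  define J where "J t = (\<Sum>i\<in>I. (m t i - z i)\<^sup>2) + (max 0 (V t - c))\<^sup>2" for t
  have w: "integrable M w" "0 \<le> w x" for x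
    unfolding w_def using F by (auto intro: sum_nonneg)
  have R: "integrable M R" "0 \<le> R x" for x
    unfolding R_def using F r by (auto intro!: sum_nonneg Bochner_Integration.integrable_sum)
  \<comment> \<open>Since \<open>w\<close> vanishes only where every \<open>F i\<close> does,
    convergence where \<open>w\<close> is nonzero controls all integrals in
    \<open>J\<close>.\<close>
  have F0: "F i x = 0" if "i \<in> I" "w x = 0" for i x
    using that sum_nonneg_eq_0_iff[OF I, of "\<lambda>i. F i x"] F(2) by (auto simp: w_def)
  have R0: "R x = 0" if "w x = 0" for x using F0 that by (simp add: R_def)
  have mint: "integrable M (\<lambda>x. t x * F i x)" if "t \<in> ?T" "i \<in> I" for t i
    using rules_integrable[OF that(1) continuous_on_id F(1)[OF that(2)]] by simp
  have Vint: "integrable M (\<lambda>x. v (t x) * R x)" if "t \<in> ?T" for t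
    by (rule rules_integrable[OF that v(1) R(1)])
  define mix where "mix \<theta> s t x = (1 - \<theta>) * s x + \<theta> * t x" for \<theta> :: real and s t :: "'a \<Rightarrow> real" and x
  have mixT: "mix \<theta> s t \<in> ?T" if st: "s \<in> ?T" "t \<in> ?T" and \<theta>: "0 \<le> \<theta>" "\<theta> \<le> 1" for \<theta> s t
  proof -
    have "mix \<theta> s t \<in> borel_measurable M"
      unfolding mix_def using rulesD(1)[OF st(1)] rulesD(1)[OF st(2)] by measurable
    moreover have "lo \<le> mix \<theta> s t x" for x
      using add_mono[OF mult_left_mono[OF rulesD(2)[OF st(1), of x], of "1-\<theta>"] mult_left_mono[OF rulesD(2)[OF st(2), of x], of \<theta>]] \<theta>
      by (simp add: mix_def algebra_simps)
    moreover have "mix \<theta> s t x \<le> hi" for x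
      using add_mono[OF mult_left_mono[OF rulesD(3)[OF st(1), of x], of "1-\<theta>"] mult_left_mono[OF rulesD(3)[OF st(2), of x], of \<theta>]] \<theta>
      by (simp add: mix_def algebra_simps)
    ultimately show ?thesis by (simp add: rules_def)
  qed
  have mmix: "m (mix \<theta> s t) i = (1 - \<theta>) * m s i + \<theta> * m t i"
    if st: "s \<in> ?T" "t \<in> ?T" and i: "i \<in> I" for \<theta> s t i
  proof -
    have "m (mix \<theta> s t) i = (\<integral>x. (1 - \<theta>) * (s x * F i x) + \<theta> * (t x * F i x) \<partial>M)"
      unfolding m_def mix_def by (intro Bochner_Integration.integral_cong) (auto simp: algebra_simps)
    then show ?thesis using mint[OF st(1) i] mint[OF st(2) i] by (simp add: m_def)
  qed
  have Vmix: "V (mix \<theta> s t) \<le> (1 - \<theta>) * V s + \<theta> * V t"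
    if st: "s \<in> ?T" "t \<in> ?T" and \<theta>: "0 \<le> \<theta>" "\<theta> \<le> 1" for \<theta> s t
  proof -
    have "V (mix \<theta> s t) \<le> (\<integral>x. (1 - \<theta>) * (v (s x) * R x) + \<theta> * (v (t x) * R x) \<partial>M)"
      unfolding V_def
    proof (intro integral_mono Vint mixT st \<theta> Bochner_Integration.integrable_add integrable_mult_right)
      fix x
      have "v (mix \<theta> s t x) \<le> (1 - \<theta>) * v (s x) + \<theta> * v (t x)"
        using convex_onD[OF v(2), of \<theta> "s x" "t x"] \<theta> by (simp add: mix_def)
      from mult_right_mono[OF this R(2)[of x]]
      show "v (mix \<theta> s t x) * R x \<le> (1 - \<theta>) * (v (s x) * R x) + \<theta> * (v (t x) * R x)"
        by (simp add: algebra_simps)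
    qed
    then show ?thesis using Vint[OF st(1)] Vint[OF st(2)] by (simp add: V_def)
  qed
  have sq: "((a + b) / 2)\<^sup>2 \<le> (a\<^sup>2 + b\<^sup>2) / 2" for a b :: real
    using sum_squares_ge_zero[of "a - b" 0] by (simp add: field_simps power2_eq_square)
  \<comment> \<open>Expected transfers are affine in the rule and the cost is convex, so each
    squared residual, including the positive part of the excess cost, is midpoint convex.\<close>
  have mid: "J (\<lambda>x. (s x + t x) / 2) \<le> max (J s) (J t)" if st: "s \<in> ?T" "t \<in> ?T" for s t
  proof -
    have eq: "(\<lambda>x. (s x + t x) / 2) = mix (1/2) s t" by (auto simp: mix_def fun_eq_iff)
    have 1: "(m (mix (1/2) s t) i - z i)\<^sup>2 \<le> ((m s i - z i)\<^sup>2 + (m t i - z i)\<^sup>2) / 2" if "i \<in> I" for i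
    proof -
      have "m (mix (1/2) s t) i - z i = ((m s i - z i) + (m t i - z i)) / 2"
        using mmix[OF st that, of "1/2"] by (simp add: field_simps)
      then show ?thesis by (simp only: sq)
    qed
    have "max 0 (V (mix (1/2) s t) - c) \<le> (max 0 (V s - c) + max 0 (V t - c)) / 2"
      using Vmix[OF st, of "1/2"] by (auto simp: max_def field_simps)
    then have "(max 0 (V (mix (1/2) s t) - c))\<^sup>2 \<le> ((max 0 (V s - c) + max 0 (V t - c)) / 2)\<^sup>2"
      by (intro power_mono) auto
    also have "\<dots> \<le> ((max 0 (V s - c))\<^sup>2 + (max 0 (V t - c))\<^sup>2) / 2" by (rule sq)
    finally have "J (mix (1/2) s t) \<le> (\<Sum>i\<in>I. ((m s i - z i)\<^sup>2 + (m t i - z i)\<^sup>2) / 2)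
        + ((max 0 (V s - c))\<^sup>2 + (max 0 (V t - c))\<^sup>2) / 2"
      unfolding J_def by (intro add_mono sum_mono 1)
    also have "\<dots> = (J s + J t) / 2"
      by (simp add: J_def sum.distrib sum_divide_distrib[symmetric] add_divide_distrib)
    finally have "J (mix (1/2) s t) \<le> (J s + J t) / 2" .
    then show ?thesis unfolding eq by (auto simp: max_def)
  qed
  have cont: "(\<lambda>k. J (u k)) \<longlonglongrightarrow> J t"
    if u: "\<And>k::nat. u k \<in> ?T" and t: "t \<in> ?T"
      and ae: "AE x in M. w x \<noteq> 0 \<longrightarrow> (\<lambda>k. u k x) \<longlonglongrightarrow> t x" for u t
  proof -
    have "(\<lambda>k. m (u k) i) \<longlonglongrightarrow> m t i" if "i \<in> I" for i
      unfolding m_def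
      by (rule rules_integral_tendsto[OF u t continuous_on_id F(1)[OF that]])
        (use ae F0[OF that] in auto)
    moreover have "(\<lambda>k. V (u k)) \<longlonglongrightarrow> V t"
      unfolding V_def by (rule rules_integral_tendsto[OF u t v(1) R(1)]) (use ae R0 in auto)
    ultimately show ?thesis unfolding J_def
      by (intro tendsto_add tendsto_sum tendsto_power tendsto_max tendsto_diff tendsto_const)
  qed
  have "\<exists>t\<in>?T. \<forall>s\<in>?T. J t \<le> J s"
    by (rule rules_attains_min[OF w lohi]) (use mid cont in \<open>auto simp: J_def sum_nonneg\<close>)
  then obtain t0 where t0: "t0 \<in> ?T" and min: "\<And>t. t \<in> ?T \<Longrightarrow> J t0 \<le> J t" by blast
  define \<alpha> where "\<alpha> i = m t0 i - z i" for i
  define \<beta> where "\<beta> = max 0 (V t0 - c)"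
  define d where "d = J t0"
  have d: "d = (\<Sum>i\<in>I. (\<alpha> i)\<^sup>2) + \<beta>\<^sup>2" by (simp add: d_def J_def \<alpha>_def \<beta>_def)
  \<comment> \<open>First-order condition: moving from \<open>t0\<close> towards \<open>t\<close> by
    \<open>\<theta>\<close> cannot lower \<open>J\<close>. Here \<open>p\<close> is the inner
    product of the residuals with the displacement of \<open>t\<close> from the target; dividing the
    comparison by \<open>\<theta>\<close> leaves an error linear in \<open>\<theta>\<close>.\<close>
  have sep: "d \<le> (\<Sum>i\<in>I. \<alpha> i * (m t i - z i)) + \<beta> * (V t - c)" if t: "t \<in> ?T" for t
  proof -
    define p where "p = (\<Sum>i\<in>I. \<alpha> i * (m t i - z i)) + \<beta> * (V t - c)"
    define B where "B = (\<Sum>i\<in>I. (m t i - z i)\<^sup>2) + (V t - c)\<^sup>2"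
    have "2 * (d - p) \<le> \<theta> * (d - 2 * p + B)" if \<theta>: "0 < \<theta>" "\<theta> < 1" for \<theta>
    proof -
      have mm: "m (mix \<theta> t0 t) i - z i = (1 - \<theta>) * \<alpha> i + \<theta> * (m t i - z i)" if "i \<in> I" for i
        using mmix[OF t0 t that] by (simp add: \<alpha>_def algebra_simps)
      have "V (mix \<theta> t0 t) - c \<le> (1 - \<theta>) * (V t0 - c) + \<theta> * (V t - c)"
        using Vmix[OF t0 t, of \<theta>] \<theta> by (simp add: algebra_simps)
      also have "\<dots> \<le> (1 - \<theta>) * \<beta> + \<theta> * (V t - c)"
        using \<theta> by (intro add_right_mono mult_left_mono) (auto simp: \<beta>_def)
      \<comment> \<open>Passing to an absolute value lets squaring remove the positive part, so that
        a quadratic polynomial in \<open>\<theta>\<close> remains.\<close>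
      finally have "max 0 (V (mix \<theta> t0 t) - c) \<le> \<bar>(1 - \<theta>) * \<beta> + \<theta> * (V t - c)\<bar>" by linarith
      then have "(max 0 (V (mix \<theta> t0 t) - c))\<^sup>2 \<le> ((1 - \<theta>) * \<beta> + \<theta> * (V t - c))\<^sup>2"
        using power_mono[of "max 0 (V (mix \<theta> t0 t) - c)" _ 2] by fastforce
      then have "J (mix \<theta> t0 t) \<le> (\<Sum>i\<in>I. ((1 - \<theta>) * \<alpha> i + \<theta> * (m t i - z i))\<^sup>2)
          + ((1 - \<theta>) * \<beta> + \<theta> * (V t - c))\<^sup>2"
        unfolding J_def using mm by (simp add: add_mono)
      also have "\<dots> = (1 - \<theta>)\<^sup>2 * d + 2 * \<theta> * (1 - \<theta>) * p + \<theta>\<^sup>2 * B"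
      proof -
        have ex: "((1 - \<theta>) * a + \<theta> * b)\<^sup>2 = (1 - \<theta>)\<^sup>2 * a\<^sup>2 + 2 * \<theta> * (1 - \<theta>) * (a * b) + \<theta>\<^sup>2 * b\<^sup>2" for a b
          by (simp add: power2_eq_square algebra_simps)
        show ?thesis
          unfolding ex sum.distrib sum_distrib_left[symmetric] d p_def B_def by (simp only: distrib_left)
      qed
      finally have "d \<le> (1 - \<theta>)\<^sup>2 * d + 2 * \<theta> * (1 - \<theta>) * p + \<theta>\<^sup>2 * B"
        using min[OF mixT[OF t0 t, of \<theta>]] \<theta> by (simp add: d_def)
      then have "\<theta> * (2 * (d - p)) \<le> \<theta> * (\<theta> * (d - 2 * p + B))"
        by (simp add: algebra_simps power2_eq_square)
      then show ?thesis using \<theta> by simp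
    qed
    then have "2 * (d - p) \<le> 0" by (rule nonpos_if_le_small_multiples)
    then show ?thesis by (simp add: p_def)
  qed
  have "d \<le> 0"
  proof -
    obtain u where u: "\<And>k::nat. u k \<in> rules N lo hi" "\<And>k. finite (range (u k))"
      "\<And>x. (\<lambda>k. u k x) \<longlonglongrightarrow> s x" using rules_discretization[OF s] by metis
    define E where "E k = (\<Sum>i\<in>I. \<alpha> i * (\<integral>y. u k y * G i y \<partial>N))
       + \<beta> * (\<integral>y. v (u k y) * (\<Sum>i\<in>I. r i * G i y) \<partial>N)" for k
    \<comment> \<open>The separating functional at the target; \<open>E k\<close> is its value at
      the discretised rule \<open>u k\<close>.\<close>
    define E0 where "E0 = (\<Sum>i\<in>I. \<alpha> i * z i) + \<beta> * c"
    have "d + E0 \<le> E k" for k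
    proof -
      define T where "T = range (u k)"
      have T: "finite T" "T \<noteq> {}" "T \<subseteq> {lo..hi}"
        using u(2)[of k] rulesD(2,3)[OF u(1)] by (auto simp: T_def)
      define hF where "hF \<tau> x = - \<tau> * (\<Sum>i\<in>I. \<alpha> i * F i x) + - \<beta> * v \<tau> * (\<Sum>i\<in>I. r i * F i x)" for \<tau> x
      define hG where "hG \<tau> x = - \<tau> * (\<Sum>i\<in>I. \<alpha> i * G i x) + - \<beta> * v \<tau> * (\<Sum>i\<in>I. r i * G i x)" for \<tau> x
      \<comment> \<open>\<open>H\<close> with coefficients \<open>- \<tau>\<close> and
        \<open>- \<beta> * v \<tau>\<close>, and \<open>\<alpha>\<close> for \<open>c\<close>. Each
        maximum is the negative of the pointwise minimum of the separating functional over the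
        levels in \<open>T\<close>.\<close>
      have Hk: "(\<integral>y. Max ((\<lambda>\<tau>. hG \<tau> y) ` T) \<partial>N) \<le> (\<integral>x. Max ((\<lambda>\<tau>. hF \<tau> x) ` T) \<partial>M)"
        unfolding hF_def hG_def by (rule H[OF T(1,2)])
      have hFm: "hF \<tau> \<in> borel_measurable M" for \<tau>
        unfolding hF_def
        by (intro borel_measurable_add borel_measurable_times borel_measurable_sum borel_measurable_const
            borel_measurable_integrable F(1))
      have hGm: "hG \<tau> \<in> borel_measurable N" for \<tau>
        unfolding hG_def
        by (intro borel_measurable_add borel_measurable_times borel_measurable_sum borel_measurable_const
            borel_measurable_integrable G)
      \<comment> \<open>The measurable pointwise maximiser has values in \<open>T\<close>, so it is
        a rule under \<open>F\<close> and \<open>sep\<close> bounds its integral.\<close>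
      obtain \<sigma> where "\<sigma> \<in> borel_measurable M"
        "\<forall>x. \<sigma> x \<in> T \<and> Max ((\<lambda>\<tau>. hF \<tau> x) ` T) = hF (\<sigma> x) x"
        using conjunct2[OF Max_selection[OF T(1,2) hFm]] by (rule bexE)
      then have \<sigma>: "\<sigma> \<in> borel_measurable M" "\<And>x. \<sigma> x \<in> T"
        "\<And>x. Max ((\<lambda>\<tau>. hF \<tau> x) ` T) = hF (\<sigma> x) x" by simp_all
      have \<sigma>T: "\<sigma> \<in> ?T" using \<sigma>(1,2) T(3) by (force simp: rules_def)
      have "(\<integral>x. Max ((\<lambda>\<tau>. hF \<tau> x) ` T) \<partial>M) = - ((\<Sum>i\<in>I. \<alpha> i * m \<sigma> i) + \<beta> * V \<sigma>)"
        unfolding \<sigma>(3) unfolding hF_def m_def V_def R_def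
        by (rule rules_linear_integral(2)[OF I F(1) \<sigma>T v(1)])
      also have "\<dots> \<le> - (d + E0)"
        using sep[OF \<sigma>T] by (simp add: E0_def algebra_simps sum_subtractf)
      finally have 1: "(\<integral>y. Max ((\<lambda>\<tau>. hG \<tau> y) ` T) \<partial>N) \<le> - (d + E0)" using Hk by simp
      \<comment> \<open>Under \<open>G\<close> the rule \<open>u k\<close> takes values in
        \<open>T\<close>, so its integrand is at most the maximum; expressing the maximum through
        \<open>\<rho>\<close> supplies integrability.\<close>
      obtain \<rho> where "\<rho> \<in> borel_measurable N"
        "\<forall>x. \<rho> x \<in> T \<and> Max ((\<lambda>\<tau>. hG \<tau> x) ` T) = hG (\<rho> x) x"
        using conjunct2[OF Max_selection[OF T(1,2) hGm]] by (rule bexE)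
      then have \<rho>: "\<rho> \<in> borel_measurable N" "\<And>x. \<rho> x \<in> T"
        "\<And>x. Max ((\<lambda>\<tau>. hG \<tau> x) ` T) = hG (\<rho> x) x" by simp_all
      have \<rho>T: "\<rho> \<in> rules N lo hi" using \<rho>(1,2) T(3) by (force simp: rules_def)
      have "- E k = (\<integral>y. hG (u k y) y \<partial>N)"
        unfolding E_def hG_def by (rule rules_linear_integral(2)[OF I G u(1) v(1), symmetric])
      also have "\<dots> \<le> (\<integral>y. hG (\<rho> y) y \<partial>N)"
      proof (rule integral_mono)
        show "integrable N (\<lambda>y. hG (u k y) y)" "integrable N (\<lambda>y. hG (\<rho> y) y)"
          unfolding hG_def
          by (rule rules_linear_integral(1)[OF I G u(1) v(1)], assumption)
            (rule rules_linear_integral(1)[OF I G \<rho>T v(1)])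
        show "hG (u k y) y \<le> hG (\<rho> y) y" for y
          unfolding \<rho>(3)[symmetric] using T(1) by (intro Max_ge) (auto simp: T_def)
      qed
      finally show ?thesis using 1 by (simp add: \<rho>(3))
    qed
    moreover have "E \<longlonglongrightarrow> E0"
    proof -
      have "(\<lambda>k. \<integral>y. u k y * G i y \<partial>N) \<longlonglongrightarrow> z i" if "i \<in> I" for i
        unfolding z_def by (rule rules_integral_tendsto[OF u(1) s continuous_on_id G[OF that]]) (use u(3) in auto)
      moreover have "(\<lambda>k. \<integral>y. v (u k y) * (\<Sum>i\<in>I. r i * G i y) \<partial>N) \<longlonglongrightarrow> c"
        unfolding c_def
        by (rule rules_integral_tendsto[OF u(1) s v(1)])
          (use u(3) G in \<open>auto intro!: Bochner_Integration.integrable_sum\<close>)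
      ultimately show ?thesis unfolding E_def E0_def
        by (intro tendsto_add tendsto_sum tendsto_mult_left)
    qed
    ultimately have "d + E0 \<le> E0" by (intro LIMSEQ_le_const) auto
    then show ?thesis by simp
  qed
  moreover have "0 \<le> (\<Sum>i\<in>I. (\<alpha> i)\<^sup>2)" "0 \<le> \<beta>\<^sup>2" by (auto intro: sum_nonneg)
  ultimately have "(\<Sum>i\<in>I. (\<alpha> i)\<^sup>2) = 0" "\<beta>\<^sup>2 = 0" using d by linarith+
  then have "\<forall>i\<in>I. \<alpha> i = 0" "\<beta> = 0"
    using sum_nonneg_eq_0_iff[OF I, of "\<lambda>i. (\<alpha> i)\<^sup>2"] by auto
  then have eqs: "m t0 i = z i" if "i \<in> I" for i using that by (simp add: \<alpha>_def)
  have "V t0 - c \<le> \<beta>" by (simp add: \<beta>_def)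
  then have Vle: "V t0 \<le> c" using \<open>\<beta> = 0\<close> by simp
  show ?thesis
    using eqs Vle unfolding m_def V_def z_def c_def R_def
    by (intro bexI[OF _ t0] conjI ballI)
qed

subsection \<open>The LB order and maxima of linear forms\<close>

text \<open>Extension by 0 makes the density nonnegative and integrable on the whole line, whatever
  \<open>f\<close> does outside the signal interval, so the results for general measures apply to
  \<open>lborel\<close>.\<close>

definition dens :: "real \<Rightarrow> real \<Rightarrow> (nat \<Rightarrow> real \<Rightarrow> real) \<Rightarrow> nat \<Rightarrow> real \<Rightarrow> real" where
  "dens xl xu f i x = indicator {xl..xu} x * f i x"

lemma LINT_dens: "(LINT x:{xl..xu}|lborel. h x * f i x) = (\<integral>x. h x * dens xl xu f i x \<partial>lborel)"
  by (simp add: set_lebesgue_integral_def dens_def mult_ac)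

lemma experiment_dens:
  assumes "is_experiment n xl xu f" and "i \<in> {0..n}"
  shows "integrable lborel (dens xl xu f i)" "0 \<le> dens xl xu f i x" "(\<integral>x. dens xl xu f i x \<partial>lborel) = 1"
proof -
  have eq: "dens xl xu f i = (\<lambda>x. indicator {xl..xu} x *\<^sub>R f i x)" by (auto simp: dens_def)
  have "set_integrable lborel {xl..xu} (f i)" "(LINT x:{xl..xu}|lborel. f i x) = 1"
    using assms by (auto simp: is_experiment_def)
  then show "integrable lborel (dens xl xu f i)" "(\<integral>x. dens xl xu f i x \<partial>lborel) = 1"
    unfolding eq set_integrable_def set_lebesgue_integral_def by auto
  show "0 \<le> dens xl xu f i x"
    using assms by (auto simp: is_experiment_def dens_def indicator_def)
qed

lemma fullp_nonneg: "q \<in> tsimplex n \<Longrightarrow> i \<in> {0..n} \<Longrightarrow> 0 \<le> fullp n q i"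
  by (auto simp: tsimplex_def fullp_def)

lemma sum_fullp: "sum (fullp n q) {0..n} = 1"
proof -
  have "sum (fullp n q) {Suc 0..n} = sum q {1..n}"
    by (rule sum.cong) (auto simp: fullp_def)
  then show ?thesis by (simp add: sum.atLeast_Suc_atMost fullp_def)
qed

lemma fullp_le_1: "q \<in> tsimplex n \<Longrightarrow> i \<in> {0..n} \<Longrightarrow> fullp n q i \<le> 1"
  using member_le_sum[of i "{0..n}" "fullp n q"] fullp_nonneg[of q n] sum_fullp[of n q] by auto

section \<open>Finite maxima: integrability, convexity, scaling and perturbation\<close>

lemma integrable_Max:
  fixes h :: "'c \<Rightarrow> 'a \<Rightarrow> real"
  assumes "finite T" "T \<noteq> {}" "\<And>\<tau>. \<tau> \<in> T \<Longrightarrow> integrable M (h \<tau>)"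
  shows "integrable M (\<lambda>x. Max ((\<lambda>\<tau>. h \<tau> x) ` T))"
  using assms by (induction T rule: finite_ne_induct) auto

lemma convex_on_Max:
  fixes h :: "'c \<Rightarrow> real \<Rightarrow> real"
  assumes "finite T" "T \<noteq> {}" "\<And>\<tau>. \<tau> \<in> T \<Longrightarrow> convex_on UNIV (h \<tau>)"
  shows "convex_on UNIV (\<lambda>s. Max ((\<lambda>\<tau>. h \<tau> s) ` T))"
proof (rule convex_onI)
  fix t x y :: real assume t: "0 < t" "t < 1"
  have "h \<tau> ((1 - t) *\<^sub>R x + t *\<^sub>R y) \<le> (1 - t) * Max ((\<lambda>\<tau>. h \<tau> x) ` T) + t * Max ((\<lambda>\<tau>. h \<tau> y) ` T)"
    if \<tau>: "\<tau> \<in> T" for \<tau>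
  proof -
    have "h \<tau> ((1 - t) *\<^sub>R x + t *\<^sub>R y) \<le> (1 - t) * h \<tau> x + t * h \<tau> y"
      using convex_onD[OF assms(3)[OF \<tau>]] t by simp
    also have "\<dots> \<le> (1 - t) * Max ((\<lambda>\<tau>. h \<tau> x) ` T) + t * Max ((\<lambda>\<tau>. h \<tau> y) ` T)"
      using t \<tau> assms(1) by (intro add_mono mult_left_mono Max_ge) auto
    finally show ?thesis .
  qed
  then show "Max ((\<lambda>\<tau>. h \<tau> ((1 - t) *\<^sub>R x + t *\<^sub>R y)) ` T)
      \<le> (1 - t) * Max ((\<lambda>\<tau>. h \<tau> x) ` T) + t * Max ((\<lambda>\<tau>. h \<tau> y) ` T)"
    using assms(1,2) by auto
qed simp

lemma Max_mult_right:
  fixes h :: "'c \<Rightarrow> real"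
  assumes "finite T" "T \<noteq> {}" "0 \<le> c"
  shows "Max ((\<lambda>\<tau>. h \<tau> * c) ` T) = Max (h ` T) * c"
proof -
  have "mono (\<lambda>y. y * c)" using assms(3) by (auto intro: monoI mult_right_mono)
  from mono_Max_commute[OF this, of "h ` T"] show ?thesis using assms by (simp add: image_image)
qed

lemma Max_perturbation:
  fixes h h' :: "'c \<Rightarrow> real"
  assumes "finite T" "T \<noteq> {}" "\<And>\<tau>. \<tau> \<in> T \<Longrightarrow> h \<tau> \<le> h' \<tau> + e"
  shows "Max (h ` T) \<le> Max (h' ` T) + e"
proof -
  have "h \<tau> \<le> Max (h' ` T) + e" if "\<tau> \<in> T" for \<tau>
  proof -
    have "h' \<tau> \<le> Max (h' ` T)" using assms(1) that by (intro Max_ge) auto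
    then show ?thesis using assms(3)[OF that] by simp
  qed
  then show ?thesis using assms(1,2) by simp
qed

text \<open>A maximum may be multiplied through by the nonnegative mixture density. Posterior
  weights sum to 1, so state 0 is removed from the index by subtracting
  \<open>c 0 / fullp n q 0\<close> from every coefficient and restored by the shift inside the test
  function; the shifted index times the mixture density is the linear form with coefficients
  \<open>c\<close>.\<close>

lemma LB_val_eq_Max_integral:
  fixes a b :: "'c \<Rightarrow> real" and c :: "nat \<Rightarrow> real"
  assumes f: "is_experiment n xl xu f" and T: "finite T" "T \<noteq> {}"
    and q: "\<And>i. i \<in> {0..n} \<Longrightarrow> 0 < fullp n q i"
  shows "LB_val n xl xu f q (\<lambda>i. c i / fullp n q i - c 0 / fullp n q 0)
       (\<lambda>s. Max ((\<lambda>\<tau>. a \<tau> * (s + c 0 / fullp n q 0) + b \<tau>) ` T))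
     = (\<integral>x. Max ((\<lambda>\<tau>. a \<tau> * (\<Sum>i=0..n. c i * dens xl xu f i x)
            + b \<tau> * (\<Sum>i=0..n. fullp n q i * dens xl xu f i x)) ` T) \<partial>lborel)"
  unfolding LB_val_def set_lebesgue_integral_def
proof (rule Bochner_Integration.integral_cong[OF refl])
  fix x
  let ?\<gamma> = "c 0 / fullp n q 0"
  let ?s = "\<Sum>i=1..n. (c i / fullp n q i - ?\<gamma>) * postp n f q i x"
  show "indicator {xl..xu} x *\<^sub>R (Max ((\<lambda>\<tau>. a \<tau> * (?s + ?\<gamma>) + b \<tau>) ` T) * mixd n f q x)
    = Max ((\<lambda>\<tau>. a \<tau> * (\<Sum>i=0..n. c i * dens xl xu f i x)
            + b \<tau> * (\<Sum>i=0..n. fullp n q i * dens xl xu f i x)) ` T)"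
  proof (cases "x \<in> {xl..xu}")
    case False
    then show ?thesis using T by (simp add: dens_def image_constant_conv)
  next
    case True
    then have d: "dens xl xu f i x = f i x" for i by (simp add: dens_def)
    have f0: "0 \<le> f i x" if "i \<in> {0..n}" for i using f True that by (auto simp: is_experiment_def)
    have terms: "0 \<le> fullp n q i * f i x" if "i \<in> {0..n}" for i
      using f0[OF that] q[OF that] by simp
    have m0: "0 \<le> mixd n f q x" unfolding mixd_def by (intro sum_nonneg terms)
    show ?thesis
    proof (cases "mixd n f q x = 0")
      case m: True
      \<comment> \<open>Where the mixture density vanishes, a positive prior forces all densities to
        vanish, so both sides are 0 regardless of the quotient in \<open>postp\<close>.\<close>
      then have "fullp n q i * f i x = 0" if "i \<in> {0..n}" for i
        using sum_nonneg_eq_0_iff[of "{0..n}" "\<lambda>i. fullp n q i * f i x"] terms that by (auto simp: mixd_def)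
      then have "f i x = 0" if "i \<in> {0..n}" for i using q that by fastforce
      then have "(\<Sum>i=0..n. c i * f i x) = 0" "(\<Sum>i=0..n. fullp n q i * f i x) = 0"
        by auto
      then show ?thesis unfolding d using m T by (simp add: image_constant_conv)
    next
      case m: False
      have "?s * mixd n f q x = (\<Sum>i=1..n. (c i / fullp n q i - ?\<gamma>) * (fullp n q i * f i x))"
        unfolding sum_distrib_right by (rule sum.cong) (use m in \<open>auto simp: postp_def fullp_def\<close>)
      also have "\<dots> = (\<Sum>i=1..n. c i * f i x - ?\<gamma> * (fullp n q i * f i x))"
        by (rule sum.cong) (use q in \<open>auto simp: field_simps less_imp_neq[THEN not_sym]\<close>)
      also have "\<dots> = (\<Sum>i=1..n. c i * f i x) - ?\<gamma> * (\<Sum>i=1..n. fullp n q i * f i x)"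
        by (simp add: sum_subtractf sum_distrib_left)
      finally have "(?s + ?\<gamma>) * mixd n f q x = (\<Sum>i=0..n. c i * f i x)"
        using q[of 0] by (simp add: mixd_def sum.atLeast_Suc_atMost[of 0] algebra_simps)
      then have eq: "a \<tau> * (\<Sum>i=0..n. c i * f i x) + b \<tau> * (\<Sum>i=0..n. fullp n q i * f i x)
          = (a \<tau> * (?s + ?\<gamma>) + b \<tau>) * mixd n f q x" for \<tau>
        by (simp add: mixd_def[symmetric] distrib_right mult.assoc)
      show ?thesis unfolding d eq Max_mult_right[OF T m0] using True by simp
    qed
  qed
qed

lemma LB_ge_Max_integral_interior:
  fixes a b :: "'c \<Rightarrow> real" and c :: "nat \<Rightarrow> real"
  assumes f: "is_experiment n xl xu f" and g: "is_experiment n yl yu g"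
    and LB: "LB_ge n xl xu f yl yu g" and T: "finite T" "T \<noteq> {}"
    and q: "q \<in> tsimplex n" "\<And>i. i \<in> {0..n} \<Longrightarrow> 0 < fullp n q i"
  shows "(\<integral>x. Max ((\<lambda>\<tau>. a \<tau> * (\<Sum>i=0..n. c i * dens yl yu g i x)
            + b \<tau> * (\<Sum>i=0..n. fullp n q i * dens yl yu g i x)) ` T) \<partial>lborel)
     \<le> (\<integral>x. Max ((\<lambda>\<tau>. a \<tau> * (\<Sum>i=0..n. c i * dens xl xu f i x)
            + b \<tau> * (\<Sum>i=0..n. fullp n q i * dens xl xu f i x)) ` T) \<partial>lborel)"
proof -
  have "convex_on UNIV (\<lambda>s. Max ((\<lambda>\<tau>. a \<tau> * (s + \<gamma>) + b \<tau>) ` T))" for \<gamma>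
    by (intro convex_on_Max T convex_onI) (auto simp: algebra_simps)
  then have "LB_val n yl yu g q (\<lambda>i. c i / fullp n q i - c 0 / fullp n q 0)
       (\<lambda>s. Max ((\<lambda>\<tau>. a \<tau> * (s + c 0 / fullp n q 0) + b \<tau>) ` T))
    \<le> LB_val n xl xu f q (\<lambda>i. c i / fullp n q i - c 0 / fullp n q 0)
       (\<lambda>s. Max ((\<lambda>\<tau>. a \<tau> * (s + c 0 / fullp n q 0) + b \<tau>) ` T))"
    using LB q(1) unfolding LB_ge_def by blast
  then show ?thesis
    by (simp only: LB_val_eq_Max_integral[OF f T q(2)] LB_val_eq_Max_integral[OF g T q(2)])
qed

text \<open>Boundary priors are limits of priors with full support, and perturbing the prior by
  \<open>e\<close> changes both integrals by at most a multiple of \<open>e\<close>.\<close>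

lemma LB_ge_Max_integral:
  fixes a b :: "'c \<Rightarrow> real" and c :: "nat \<Rightarrow> real"
  assumes f: "is_experiment n xl xu f" and g: "is_experiment n yl yu g"
    and LB: "LB_ge n xl xu f yl yu g" and T: "finite T" "T \<noteq> {}"
    and q: "q \<in> tsimplex n"
  shows "(\<integral>x. Max ((\<lambda>\<tau>. a \<tau> * (\<Sum>i=0..n. c i * dens yl yu g i x)
            + b \<tau> * (\<Sum>i=0..n. fullp n q i * dens yl yu g i x)) ` T) \<partial>lborel)
     \<le> (\<integral>x. Max ((\<lambda>\<tau>. a \<tau> * (\<Sum>i=0..n. c i * dens xl xu f i x)
            + b \<tau> * (\<Sum>i=0..n. fullp n q i * dens xl xu f i x)) ` T) \<partial>lborel)"
proof -
  \<comment> \<open>Mixture with the uniform distribution on the \<open>n + 1\<close> states, with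
    weight \<open>e\<close>; state 0 gets its share implicitly through \<open>fullp\<close>.\<close>
  define q' where "q' e i = (if i \<in> {1..n} then (1 - e) * q i + e / (real n + 1) else 0)" for e :: real and i
  define K where "K = (\<Sum>\<tau>\<in>T. \<bar>b \<tau>\<bar>)"
  define h where "h F p \<tau> x = a \<tau> * (\<Sum>i=0..n. c i * F i x) + b \<tau> * (\<Sum>i=0..n. fullp n p i * F i x)"
    for F :: "nat \<Rightarrow> real \<Rightarrow> real" and p \<tau> x
  define I where "I F p = (\<integral>x. Max ((\<lambda>\<tau>. h F p \<tau> x) ` T) \<partial>lborel)" for F p
  have full: "fullp n (q' e) i = (1 - e) * fullp n q i + e / (real n + 1)" if "i \<in> {0..n}" for e i
  proof (cases "i = 0")
    case True
    have "sum (q' e) {1..n} = (1 - e) * sum q {1..n} + real n * (e / (real n + 1))"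
      by (simp add: q'_def sum.distrib sum_distrib_left)
    moreover have "real n * (e / (real n + 1)) = e - e / (real n + 1)" by (simp add: field_simps)
    ultimately show ?thesis using True by (simp add: fullp_def algebra_simps)
  qed (use that in \<open>auto simp: fullp_def q'_def\<close>)
  have pos: "0 < fullp n (q' e) i" if "0 < e" "e < 1" "i \<in> {0..n}" for e i
    unfolding full[OF that(3)] using fullp_nonneg[OF q that(3)] that by (intro add_nonneg_pos) auto
  have simplex: "q' e \<in> tsimplex n" if e: "0 < e" "e < 1" for e
  proof -
    have le: "sum (q' e) {1..n} \<le> 1" using pos[OF e, of 0] by (simp add: fullp_def)
    have ge: "0 \<le> q' e i" if "i \<in> {1..n}" for i
      using pos[OF e, of i] that by (auto simp: fullp_def split: if_splits)
    have "q' e i \<le> 1" if "i \<in> {1..n}" for i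
      using member_le_sum[of i "{1..n}" "q' e"] that ge le by auto
    then show ?thesis using le ge by (auto simp: tsimplex_def q'_def)
  qed
  have close: "\<bar>h F (q' e) \<tau> x - h F q \<tau> x\<bar> \<le> e * K * (\<Sum>i=0..n. F i x)"
    if e: "0 < e" "e < 1" and F: "\<And>i x. i \<in> {0..n} \<Longrightarrow> 0 \<le> F i x" and \<tau>: "\<tau> \<in> T" for F e \<tau> x
  proof -
    have "\<bar>(\<Sum>i=0..n. fullp n (q' e) i * F i x) - (\<Sum>i=0..n. fullp n q i * F i x)\<bar>
        = \<bar>\<Sum>i=0..n. (fullp n (q' e) i - fullp n q i) * F i x\<bar>"
      by (simp add: sum_subtractf left_diff_distrib)
    also have "\<dots> \<le> (\<Sum>i=0..n. \<bar>(fullp n (q' e) i - fullp n q i) * F i x\<bar>)" by (rule sum_abs)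
    also have "\<dots> \<le> (\<Sum>i=0..n. e * F i x)"
    proof (rule sum_mono)
      fix i assume i: "i \<in> {0..n}"
      have "fullp n (q' e) i - fullp n q i = e * (1 / (real n + 1) - fullp n q i)"
        unfolding full[OF i] by (simp add: algebra_simps)
      moreover have "\<bar>1 / (real n + 1) - fullp n q i\<bar> \<le> 1"
      proof -
        have "0 \<le> 1 / (real n + 1)" "1 / (real n + 1) \<le> 1" by auto
        then show ?thesis using fullp_nonneg[OF q i] fullp_le_1[OF q i] by linarith
      qed
      ultimately have "\<bar>fullp n (q' e) i - fullp n q i\<bar> \<le> e"
        using e by (simp add: abs_mult mult_left_le)
      then show "\<bar>(fullp n (q' e) i - fullp n q i) * F i x\<bar> \<le> e * F i x"
        using F[OF i, of x] by (simp add: abs_mult mult_right_mono)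
    qed
    finally have 1: "\<bar>(\<Sum>i=0..n. fullp n (q' e) i * F i x) - (\<Sum>i=0..n. fullp n q i * F i x)\<bar>
        \<le> e * (\<Sum>i=0..n. F i x)" by (simp add: sum_distrib_left)
    have "\<bar>b \<tau>\<bar> \<le> K" unfolding K_def using T(1) \<tau> by (intro member_le_sum) auto
    from mult_mono[OF this 1] have "\<bar>b \<tau>\<bar> * \<bar>(\<Sum>i=0..n. fullp n (q' e) i * F i x) - (\<Sum>i=0..n. fullp n q i * F i x)\<bar>
        \<le> K * (e * (\<Sum>i=0..n. F i x))" by (simp add: K_def sum_nonneg)
    then show ?thesis by (simp add: h_def abs_mult[symmetric] right_diff_distrib mult_ac)
  qed
  \<comment> \<open>Two directions are required: from \<open>q\<close> to \<open>q' e\<close> under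
    \<open>G\<close>, and back under \<open>F\<close>. The factor \<open>real n + 1\<close> is the
    total mass of the densities.\<close>
  have step: "I F p \<le> I F p' + e * (K * (real n + 1))"
    if e: "0 < e" "e < 1" and F: "\<And>i. i \<in> {0..n} \<Longrightarrow> integrable lborel (F i)"
      "\<And>i x. i \<in> {0..n} \<Longrightarrow> 0 \<le> F i x" "\<And>i. i \<in> {0..n} \<Longrightarrow> (\<integral>x. F i x \<partial>lborel) = 1"
      and pp: "p = q \<and> p' = q' e \<or> p = q' e \<and> p' = q" for F e p p'
  proof -
    have hint: "integrable lborel (h F p \<tau>)" for p \<tau>
      unfolding h_def
      by (intro Bochner_Integration.integrable_add integrable_mult_right Bochner_Integration.integrable_sum F(1))
    have wint: "integrable lborel (\<lambda>x. e * K * (\<Sum>i=0..n. F i x))"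
      by (intro integrable_mult_right Bochner_Integration.integrable_sum F(1))
    have Mint: "integrable lborel (\<lambda>x. Max ((\<lambda>\<tau>. h F p \<tau> x) ` T))" for p
      by (rule integrable_Max[OF T hint])
    have "I F p \<le> (\<integral>x. Max ((\<lambda>\<tau>. h F p' \<tau> x) ` T) + e * K * (\<Sum>i=0..n. F i x) \<partial>lborel)"
      unfolding I_def
    proof (intro integral_mono Mint Bochner_Integration.integrable_add wint)
      fix x
      show "Max ((\<lambda>\<tau>. h F p \<tau> x) ` T) \<le> Max ((\<lambda>\<tau>. h F p' \<tau> x) ` T) + e * K * (\<Sum>i=0..n. F i x)"
      proof (rule Max_perturbation[OF T])
        fix \<tau> assume "\<tau> \<in> T"
        from close[where F = F and x = x, OF e F(2) this] show "h F p \<tau> x \<le> h F p' \<tau> x + e * K * (\<Sum>i=0..n. F i x)"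
          using pp by (auto simp: abs_le_iff)
      qed
    qed
    also have "\<dots> = I F p' + e * K * (\<integral>x. (\<Sum>i=0..n. F i x) \<partial>lborel)"
      using Mint wint by (simp add: I_def)
    also have "(\<integral>x. (\<Sum>i=0..n. F i x) \<partial>lborel) = real n + 1"
      using F by (simp add: Bochner_Integration.integral_sum)
    finally show ?thesis by (simp add: mult_ac)
  qed
  let ?F = "dens xl xu f" and ?G = "dens yl yu g"
  have "I ?G q - I ?F q \<le> e * (2 * (K * (real n + 1)))" if e: "0 < e" "e < 1" for e
  proof -
    have "I ?G q \<le> I ?G (q' e) + e * (K * (real n + 1))"
      by (rule step[OF e experiment_dens[OF g]]) auto
    moreover have "I ?G (q' e) \<le> I ?F (q' e)"
      unfolding I_def h_def by (rule LB_ge_Max_integral_interior[OF f g LB T simplex[OF e] pos[OF e]])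
    moreover have "I ?F (q' e) \<le> I ?F q + e * (K * (real n + 1))"
      by (rule step[OF e experiment_dens[OF f]]) auto
    ultimately show ?thesis by (simp add: algebra_simps)
  qed
  then have "I ?G q - I ?F q \<le> 0" by (rule nonpos_if_le_small_multiples)
  then show ?thesis by (simp add: I_def h_def)
qed

subsection \<open>Values under LB dominance\<close>

text \<open>Feasibility restricts transfers only on the signal interval. The default
  \<open>lo\<close> outside gives a rule on the whole line, without effect on integrals against
  \<open>dens\<close>.\<close>

definition clip :: "real \<Rightarrow> real \<Rightarrow> real \<Rightarrow> (real \<Rightarrow> real) \<Rightarrow> real \<Rightarrow> real" where
  "clip lo yl yu t y = (if y \<in> {yl..yu} then t y else lo)"

lemma clip_rules:
  assumes "set_borel_measurable lborel {yl..yu} t" "\<forall>y\<in>{yl..yu}. lo \<le> t y \<and> t y \<le> hi" "lo \<le> hi"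
  shows "clip lo yl yu t \<in> rules lborel lo hi"
proof -
  have "clip lo yl yu t = (\<lambda>y. indicator {yl..yu} y *\<^sub>R t y + indicator (- {yl..yu}) y * lo)"
    by (auto simp: clip_def fun_eq_iff)
  moreover have "(\<lambda>y. indicator {yl..yu} y *\<^sub>R t y + indicator (- {yl..yu}) y * lo) \<in> borel_measurable lborel"
    using assms(1) unfolding set_borel_measurable_def by measurable
  ultimately have "clip lo yl yu t \<in> borel_measurable lborel" by simp
  then show ?thesis using assms(2,3) by (auto simp: rules_def clip_def)
qed

lemma clip_dens: "v (clip lo yl yu t y) * dens yl yu g i y = v (t y) * dens yl yu g i y"
  by (simp add: clip_def dens_def)

lemma rules_weighted_integral:
  fixes v :: "real \<Rightarrow> real"
  assumes "is_experiment n xl xu f" "t \<in> rules lborel lo hi" "continuous_on UNIV v"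
  shows "(\<integral>x. v (t x) * (\<Sum>i=0..n. r i * dens xl xu f i x) \<partial>lborel)
    = (\<Sum>i=0..n. r i * (\<integral>x. v (t x) * dens xl xu f i x \<partial>lborel))"
proof -
  have "(\<integral>x. v (t x) * (\<Sum>i=0..n. r i * dens xl xu f i x) \<partial>lborel)
    = (\<integral>x. (\<Sum>i=0..n. r i * (v (t x) * dens xl xu f i x)) \<partial>lborel)"
    by (simp add: sum_distrib_left mult_ac)
  also have "\<dots> = (\<Sum>i=0..n. r i * (\<integral>x. v (t x) * dens xl xu f i x \<partial>lborel))"
    using rules_integrable[OF assms(2,3) experiment_dens(1)[OF assms(1)]]
    by (simp add: Bochner_Integration.integral_sum)
  finally show ?thesis .
qed

text \<open>Expected transfers agree state by state, so they agree under the beliefs of all types,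
  truthful or not. The cost is compared only under the belief \<open>p\<close> of the type meant to
  receive the transfer.\<close>

lemma LB_ge_transfer:
  fixes v :: "real \<Rightarrow> real"
  assumes f: "is_experiment n xl xu f" and g: "is_experiment n yl yu g"
    and LB: "LB_ge n xl xu f yl yu g" and p: "p \<in> tsimplex n"
    and lohi: "lo \<le> hi" and v: "continuous_on UNIV v" "convex_on UNIV v"
    and t: "set_borel_measurable lborel {yl..yu} t" "\<forall>y\<in>{yl..yu}. lo \<le> t y \<and> t y \<le> hi"
  shows "\<exists>s\<in>rules lborel lo hi.
    (\<forall>i\<in>{0..n}. (LINT x:{xl..xu}|lborel. s x * f i x) = (LINT y:{yl..yu}|lborel. t y * g i y)) \<and>
    (\<Sum>i=0..n. fullp n p i * (LINT x:{xl..xu}|lborel. v (s x) * f i x))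
      \<le> (\<Sum>i=0..n. fullp n p i * (LINT y:{yl..yu}|lborel. v (t y) * g i y))"
proof -
  let ?t = "clip lo yl yu t"
  have tr: "?t \<in> rules lborel lo hi" by (rule clip_rules[OF t lohi])
  have "\<exists>s\<in>rules lborel lo hi.
    (\<forall>i\<in>{0..n}. (\<integral>x. s x * dens xl xu f i x \<partial>lborel) = (\<integral>y. ?t y * dens yl yu g i y \<partial>lborel)) \<and>
    (\<integral>x. v (s x) * (\<Sum>i=0..n. fullp n p i * dens xl xu f i x) \<partial>lborel)
      \<le> (\<integral>y. v (?t y) * (\<Sum>i=0..n. fullp n p i * dens yl yu g i y) \<partial>lborel)"
    by (rule rule_transfer[OF finite_atLeastAtMost experiment_dens(1,2)[OF f] experiment_dens(1)[OF g]
          fullp_nonneg[OF p] lohi v LB_ge_Max_integral[OF f g LB _ _ p] tr])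
  then obtain s where s: "s \<in> rules lborel lo hi"
    and eq: "\<forall>i\<in>{0..n}. (\<integral>x. s x * dens xl xu f i x \<partial>lborel) = (\<integral>y. ?t y * dens yl yu g i y \<partial>lborel)"
    and le: "(\<integral>x. v (s x) * (\<Sum>i=0..n. fullp n p i * dens xl xu f i x) \<partial>lborel)
      \<le> (\<integral>y. v (?t y) * (\<Sum>i=0..n. fullp n p i * dens yl yu g i y) \<partial>lborel)" by blast
  show ?thesis
  proof (intro bexI[OF _ s] conjI)
    show "\<forall>i\<in>{0..n}. (LINT x:{xl..xu}|lborel. s x * f i x) = (LINT y:{yl..yu}|lborel. t y * g i y)"
      using eq clip_dens[of "\<lambda>z. z" lo yl yu t _ g] unfolding LINT_dens by simp
    show "(\<Sum>i=0..n. fullp n p i * (LINT x:{xl..xu}|lborel. v (s x) * f i x))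
      \<le> (\<Sum>i=0..n. fullp n p i * (LINT y:{yl..yu}|lborel. v (t y) * g i y))"
      using le unfolding rules_weighted_integral[OF f s v(1)] rules_weighted_integral[OF g tr v(1)]
        LINT_dens[where f = f] LINT_dens[where f = g]
      by (simp only: clip_dens[of v])
  qed
qed

lemma LB_ge_imp_Wval_ge:
  assumes f: "is_experiment n xl xu f" and g: "is_experiment n yl yu g"
    and LB: "LB_ge n xl xu f yl yu g" and env: "screening_env n k q P \<pi> \<psi> v2 mlo mhi"
  shows "Wval n yl yu g k P \<pi> \<psi> v1 v2 u1 mlo mhi \<le> Wval n xl xu f k P \<pi> \<psi> v1 v2 u1 mlo mhi"
  unfolding Wval_def
proof (rule SUP_least)
  fix m assume "m \<in> {(ah, t). feasible n yl yu g k P \<psi> u1 mlo mhi ah t}"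
  then obtain ah t where m: "m = (ah, t)" and feas: "feasible n yl yu g k P \<psi> u1 mlo mhi ah t" by auto
  have env': "P \<subseteq> tsimplex n" "\<And>p. p \<in> P \<Longrightarrow> 0 \<le> \<pi> p" "\<And>a. a \<in> {0..k} \<Longrightarrow> 0 \<le> \<psi> a"
    "continuous_on UNIV v2" "convex_on UNIV v2" "mlo \<le> mhi"
    using env by (auto simp: screening_env_def)
  have ah: "0 \<le> ah p a" if "p \<in> P" "a \<in> {0..k}" for p a using feas that by (auto simp: feasible_def)
  define good where "good p a s \<longleftrightarrow> s \<in> rules lborel mlo mhi \<and>
    (\<forall>i\<in>{0..n}. (LINT x:{xl..xu}|lborel. s x * f i x) = (LINT y:{yl..yu}|lborel. t p a (Some y) * g i y)) \<and>
    (\<Sum>i=0..n. fullp n p i * (LINT x:{xl..xu}|lborel. v2 (s x) * f i x))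
      \<le> (\<Sum>i=0..n. fullp n p i * (LINT y:{yl..yu}|lborel. v2 (t p a (Some y)) * g i y))" for p a s
  have "\<exists>s. good p a s" if "p \<in> P" "a \<in> {0..k}" for p a
    unfolding good_def Bex_def[symmetric]
  proof (rule LB_ge_transfer[OF f g LB subsetD[OF env'(1) that(1)] env'(6,4,5)])
    show "set_borel_measurable lborel {yl..yu} (\<lambda>y. t p a (Some y))"
      "\<forall>y\<in>{yl..yu}. mlo \<le> t p a (Some y) \<and> t p a (Some y) \<le> mhi"
      using feas that unfolding feasible_def by blast+
  qed
  note good = someI_ex[OF this]
  define s where "s p a = (SOME s. good p a s)" for p a
  have s: "s p a \<in> rules lborel mlo mhi"
    and s_eq: "\<And>i. i \<in> {0..n} \<Longrightarrow>
      (LINT x:{xl..xu}|lborel. s p a x * f i x) = (LINT y:{yl..yu}|lborel. t p a (Some y) * g i y)"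
    and s_le: "(\<Sum>i=0..n. fullp n p i * (LINT x:{xl..xu}|lborel. v2 (s p a x) * f i x))
      \<le> (\<Sum>i=0..n. fullp n p i * (LINT y:{yl..yu}|lborel. v2 (t p a (Some y)) * g i y))"
    if "p \<in> P" "a \<in> {0..k}" for p a
    using good[OF that] unfolding s_def good_def by blast+
  define t' where "t' p a z = (case z of None \<Rightarrow> t p a None | Some x \<Rightarrow> s p a x)" for p a z
  have t': "t' p a None = t p a None" "t' p a (Some x) = s p a x" for p a x by (auto simp: t'_def)
  \<comment> \<open>Holds for every true type \<open>p\<close>, because the equality is per state;
    participation and incentive constraints therefore carry over together.\<close>
  have U: "agentU n xl xu f k \<psi> u1 ah t' p p' = agentU n yl yu g k \<psi> u1 ah t p p'" if "p' \<in> P" for p p'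
    unfolding agentU_def t' using s_eq[OF that] by (intro sum.cong refl) auto
  have feas': "feasible n xl xu f k P \<psi> u1 mlo mhi ah t'"
    unfolding feasible_def
  proof (intro conjI ballI)
    fix p a assume p: "p \<in> P" and a: "a \<in> {0..k}"
    show "set_borel_measurable lborel {xl..xu} (\<lambda>x. t' p a (Some x))"
      unfolding t' set_borel_measurable_def using rulesD(1)[OF s[OF p a]] by measurable
  qed (use feas rulesD(2,3)[OF s] U in \<open>auto simp: feasible_def t'\<close>)
  have "principal_obj n yl yu g k P \<pi> \<psi> v1 v2 ah t \<le> principal_obj n xl xu f k P \<pi> \<psi> v1 v2 ah t'"
    unfolding principal_obj_def
  proof (rule sum_mono, rule mult_left_mono[OF sum_mono[OF mult_left_mono]])
    fix p a assume p: "p \<in> P" and a: "a \<in> {0..k}"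
    \<comment> \<open>Isolates the cost after an informative signal, the only term that changes; it
      enters with the nonpositive factor \<open>- \<psi> a\<close>.\<close>
    have split: "(\<Sum>i=0..n. fullp n p i * (v1 a i - (\<psi> a * X i + (1 - \<psi> a) * Y)))
      = (\<Sum>i=0..n. fullp n p i * (v1 a i - (1 - \<psi> a) * Y)) - \<psi> a * (\<Sum>i=0..n. fullp n p i * X i)" for X Y
      by (simp add: sum_distrib_left sum_subtractf[symmetric] algebra_simps)
    show "(\<Sum>i=0..n. fullp n p i * (v1 a i - (\<psi> a * (LINT x:{yl..yu}|lborel. v2 (t p a (Some x)) * g i x)
                   + (1 - \<psi> a) * v2 (t p a None))))
      \<le> (\<Sum>i=0..n. fullp n p i * (v1 a i - (\<psi> a * (LINT x:{xl..xu}|lborel. v2 (t' p a (Some x)) * f i x)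
                   + (1 - \<psi> a) * v2 (t' p a None))))"
      unfolding split t' using s_le[OF p a] env'(3)[OF a] by (intro diff_left_mono mult_left_mono) auto
  qed (auto intro: ah env'(2))
  then show "ereal (principal_obj n yl yu g k P \<pi> \<psi> v1 v2 (fst m) (snd m))
     \<le> (SUP m\<in>{(ah, t). feasible n xl xu f k P \<psi> u1 mlo mhi ah t}.
           ereal (principal_obj n xl xu f k P \<pi> \<psi> v1 v2 (fst m) (snd m)))"
    using feas' by (intro SUP_upper2[where i = "(ah, t')"]) (auto simp: m)
qed

subsection \<open>The LB order from absolute values of linear forms\<close>

text \<open>Piecewise linear interpolation on a fine grid. Convexity makes the slopes
  \<open>D\<close> increase, so the kinks have nonnegative weights, and \<open>max 0 y\<close> is
  half of \<open>y + \<bar>y\<bar>\<close>.\<close>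

lemma convex_abs_approximation:
  fixes C :: "real \<Rightarrow> real"
  assumes C: "convex_on UNIV C" and e: "0 < e"
  obtains N :: nat and k0 k1 and w c :: "nat \<Rightarrow> real"
  where "\<And>j. 0 \<le> w j"
    "\<And>s. - R \<le> s \<Longrightarrow> s \<le> R \<Longrightarrow> \<bar>C s - (k0 + k1 * s + (\<Sum>j<N. w j * \<bar>s - c j\<bar>))\<bar> \<le> e"
proof -
  have "continuous_on UNIV C" by (rule convex_on_continuous[OF _ C]) simp
  \<comment> \<open>The margin 1 accommodates the grid point after \<open>s\<close>, which may pass
    \<open>R\<close> by up to \<open>h \<le> 1\<close>.\<close>
  then have "continuous_on {- R..R + 1} C" by (rule continuous_on_subset) simp
  then have "uniformly_continuous_on {- R..R + 1} C"
    by (rule compact_uniformly_continuous) simp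
  then obtain d where d: "0 < d"
    "\<And>x y. x \<in> {- R..R + 1} \<Longrightarrow> y \<in> {- R..R + 1} \<Longrightarrow> dist y x < d \<Longrightarrow> dist (C y) (C x) < e / 2"
    unfolding uniformly_continuous_on_def by (elim allE[of _ "e / 2"]) (use e in auto)
  define h where "h = min 1 (d / 2)"
  have h: "0 < h" "h \<le> 1" "h < d" using d(1) by (auto simp: h_def)
  define x where "x j = - R + real j * h" for j
  define D where "D j = (C (x (Suc j)) - C (x j)) / h" for j
  have xS: "x (Suc j) = x j + h" for j by (simp add: x_def algebra_simps)
  have D_mono: "D j \<le> D (Suc j)" for j
  proof -
    have mid: "(1 - 1/2) *\<^sub>R x j + (1/2) *\<^sub>R x (Suc (Suc j)) = x (Suc j)" by (simp add: xS field_simps)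
    have "C (x (Suc j)) \<le> (C (x j) + C (x (Suc (Suc j)))) / 2"
      using convex_onD[OF C, of "1/2" "x j" "x (Suc (Suc j))"] unfolding mid by simp
    then show ?thesis using h by (simp add: D_def divide_right_mono)
  qed
  \<comment> \<open>The interpolant as a sum of kinks. To the right of \<open>x m\<close> the first
    \<open>m\<close> kinks add up to the chord through \<open>x m\<close>; to the left of
    \<open>x (Suc m)\<close> the later ones are inactive.\<close>
  define L where "L m s = C (x 0) + D 0 * (s - x 0) + (\<Sum>j<m. (D (Suc j) - D j) * max 0 (s - x (Suc j)))" for m s
  have L_ge: "L m s = C (x m) + D m * (s - x m)" if "x m \<le> s" for m s
    using that
  proof (induction m)
    case (Suc m)
    have le: "x m \<le> s" using Suc.prems h by (simp add: xS)
    have "L (Suc m) s = L m s + (D (Suc m) - D m) * (s - x (Suc m))"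
      using Suc.prems by (simp add: L_def max_def)
    also have "\<dots> = C (x m) + D m * h + D (Suc m) * (s - x (Suc m))"
      using Suc.IH[OF le] by (simp add: xS algebra_simps)
    also have "C (x m) + D m * h = C (x (Suc m))" using h by (simp add: D_def)
    finally show ?case .
  qed (simp add: L_def)
  have L_le: "L (m + l) s = L m s" if "s \<le> x (Suc m)" for m l s
  proof (induction l)
    case (Suc l)
    have "x (Suc m) \<le> x (Suc (m + l))" using h by (simp add: x_def mult_right_mono)
    then have "max 0 (s - x (Suc (m + l))) = 0" using that by simp
    then have "L (Suc (m + l)) s = L (m + l) s" by (simp add: L_def)
    then show ?case using Suc by simp
  qed simp
  define N where "N = nat \<lfloor>2 * R / h\<rfloor>"
  have approx: "\<bar>C s - L N s\<bar> \<le> e" if s: "- R \<le> s" "s \<le> R" for s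
  proof -
    define i where "i = nat \<lfloor>(s + R) / h\<rfloor>"
    have nn: "0 \<le> (s + R) / h" using s h by simp
    have fl: "real i \<le> (s + R) / h" "(s + R) / h < real i + 1"
      using nn by (simp_all add: i_def)
    have xi: "x i \<le> s" "s \<le> x (Suc i)"
      using fl h by (auto simp: x_def field_simps)
    have "(s + R) / h \<le> 2 * R / h" using s h by (intro divide_right_mono) auto
    then have "i \<le> N" unfolding i_def N_def by (intro nat_mono floor_mono)
    then have "L N s = L i s" using L_le[OF xi(2), of "N - i"] by simp
    also have "\<dots> = C (x i) + D i * (s - x i)" by (rule L_ge[OF xi(1)])
    also have "D i * (s - x i) = (C (x (Suc i)) - C (x i)) * ((s - x i) / h)" by (simp add: D_def)
    \<comment> \<open>The error is a difference of two increments of \<open>C\<close> within one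
      grid cell, the second scaled by a factor at most 1; each is at most
      \<open>e / 2\<close>.\<close>
    finally have eq: "C s - L N s = (C s - C (x i)) - (C (x (Suc i)) - C (x i)) * ((s - x i) / h)" by simp
    have in_int: "x i \<in> {- R..R + 1}" "x (Suc i) \<in> {- R..R + 1}" "s \<in> {- R..R + 1}"
      using xi s h by (auto simp: xS) (auto simp: x_def)
    have dists: "dist s (x i) < d" "dist (x (Suc i)) (x i) < d"
      using xi h unfolding xS dist_real_def by linarith+
    have 1: "\<bar>C s - C (x i)\<bar> \<le> e / 2"
      using d(2)[OF in_int(1,3) dists(1)] unfolding dist_real_def by linarith
    have 2: "\<bar>C (x (Suc i)) - C (x i)\<bar> \<le> e / 2"
      using d(2)[OF in_int(1,2) dists(2)] unfolding dist_real_def by linarith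
    have "\<bar>(s - x i) / h\<bar> \<le> 1" using xi h by (simp add: xS)
    with 2 have "\<bar>C (x (Suc i)) - C (x i)\<bar> * \<bar>(s - x i) / h\<bar> \<le> e / 2 * 1"
      using e by (intro mult_mono) auto
    then have "\<bar>(C (x (Suc i)) - C (x i)) * ((s - x i) / h)\<bar> \<le> e / 2" unfolding abs_mult by simp
    with 1 show ?thesis unfolding eq by linarith
  qed
  define w where "w j = (D (Suc j) - D j) / 2" for j
  have L_abs: "L N s = (C (x 0) - D 0 * x 0 - (\<Sum>j<N. w j * x (Suc j))) + (D 0 + (\<Sum>j<N. w j)) * s
      + (\<Sum>j<N. w j * \<bar>s - x (Suc j)\<bar>)" for s
  proof -
    have "(D (Suc j) - D j) * max 0 (s - x (Suc j)) = w j * s - w j * x (Suc j) + w j * \<bar>s - x (Suc j)\<bar>" for j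
      by (simp add: w_def max_def abs_if field_simps)
    then have "(\<Sum>j<N. (D (Suc j) - D j) * max 0 (s - x (Suc j)))
      = (\<Sum>j<N. w j) * s - (\<Sum>j<N. w j * x (Suc j)) + (\<Sum>j<N. w j * \<bar>s - x (Suc j)\<bar>)"
      by (simp only: sum.distrib sum_subtractf sum_distrib_right)
    then show ?thesis by (simp add: L_def algebra_simps)
  qed
  show ?thesis
  proof (rule that)
    show "0 \<le> w j" for j using D_mono by (simp add: w_def)
    show "\<bar>C s - ((C (x 0) - D 0 * x 0 - (\<Sum>j<N. w j * x (Suc j))) + (D 0 + (\<Sum>j<N. w j)) * s
      + (\<Sum>j<N. w j * \<bar>s - x (Suc j)\<bar>))\<bar> \<le> e" if "- R \<le> s" "s \<le> R" for s
      using approx[OF that] by (simp only: L_abs)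
  qed
qed

section \<open>Integrals of functions of a posterior index\<close>

lemma mixd_dens:
  assumes "is_experiment n xl xu f" "q \<in> tsimplex n"
  shows "integrable lborel (mixd n (dens xl xu f) q)" "0 \<le> mixd n (dens xl xu f) q x"
    "(\<integral>x. mixd n (dens xl xu f) q x \<partial>lborel) = 1"
proof -
  note F = experiment_dens[OF assms(1)]
  have eq: "mixd n (dens xl xu f) q = (\<lambda>x. \<Sum>j=0..n. fullp n q j * dens xl xu f j x)"
    by (simp add: mixd_def fun_eq_iff)
  show "integrable lborel (mixd n (dens xl xu f) q)" unfolding eq
    by (intro Bochner_Integration.integrable_sum integrable_mult_right F)
  show "0 \<le> mixd n (dens xl xu f) q x" unfolding eq
    by (intro sum_nonneg mult_nonneg_nonneg F(2) fullp_nonneg[OF assms(2)])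
  show "(\<integral>x. mixd n (dens xl xu f) q x \<partial>lborel) = 1" unfolding eq
    using F sum_fullp[of n q] by (simp add: Bochner_Integration.integral_sum)
qed

lemma LB_val_dens:
  "LB_val n xl xu f q b C = (\<integral>x. C (\<Sum>i=1..n. b i * postp n (dens xl xu f) q i x)
      * mixd n (dens xl xu f) q x \<partial>lborel)"
  unfolding LB_val_def set_lebesgue_integral_def
  by (intro Bochner_Integration.integral_cong) (auto simp: dens_def mixd_def postp_def indicator_def)

text \<open>Posterior weights lie between 0 and 1. Viewing the index as a bounded rule reuses the
  integrability results and confines it to a compact interval for the approximation of
  \<open>C\<close>.\<close>

lemma posterior_index_rules:
  assumes f: "is_experiment n xl xu f" and q: "q \<in> tsimplex n"
  shows "(\<lambda>x. \<Sum>i=1..n. b i * postp n (dens xl xu f) q i x)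
    \<in> rules lborel (- (\<Sum>i=1..n. \<bar>b i\<bar>)) (\<Sum>i=1..n. \<bar>b i\<bar>)"
proof -
  let ?F = "dens xl xu f"
  note F = experiment_dens[OF f]
  have post: "\<bar>postp n ?F q i x\<bar> \<le> 1" if "i \<in> {1..n}" for i x
  proof -
    have "fullp n q i * ?F i x \<le> mixd n ?F q x"
      unfolding mixd_def using that fullp_nonneg[OF q] F(2) by (intro member_le_sum) auto
    moreover have "0 \<le> fullp n q i * ?F i x" using that fullp_nonneg[OF q] F(2) by auto
    ultimately show ?thesis using that mixd_dens(2)[OF f q, of x]
      by (auto simp: postp_def fullp_def divide_le_eq_1)
  qed
  have "\<bar>\<Sum>i=1..n. b i * postp n ?F q i x\<bar> \<le> (\<Sum>i=1..n. \<bar>b i\<bar>)" for x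
  proof -
    have "\<bar>\<Sum>i=1..n. b i * postp n ?F q i x\<bar> \<le> (\<Sum>i=1..n. \<bar>b i * postp n ?F q i x\<bar>)" by (rule sum_abs)
    also have "\<dots> \<le> (\<Sum>i=1..n. \<bar>b i\<bar>)"
      using post by (intro sum_mono) (simp add: abs_mult mult_left_le)
    finally show ?thesis .
  qed
  moreover have "(\<lambda>x. \<Sum>i=1..n. b i * postp n ?F q i x) \<in> borel_measurable lborel"
    unfolding postp_def
    by (intro borel_measurable_sum borel_measurable_times borel_measurable_divide borel_measurable_const
        borel_measurable_integrable mixd_dens(1)[OF f q] F(1)) auto
  ultimately show ?thesis by (simp add: rules_def abs_le_iff minus_le_iff)
qed

text \<open>Multiplication clears the denominator of the posterior. The identity survives where the
  mixture density is 0, since each nonnegative summand then vanishes.\<close>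

lemma posterior_index_mixd:
  assumes f: "is_experiment n xl xu f" and q: "q \<in> tsimplex n"
  shows "((\<Sum>i=1..n. b i * postp n (dens xl xu f) q i x) - c) * mixd n (dens xl xu f) q x
    = (\<Sum>i=0..n. ((if i = 0 then 0 else b i) - c) * fullp n q i * dens xl xu f i x)"
proof -
  let ?F = "dens xl xu f"
  have "b i * postp n ?F q i x * mixd n ?F q x = b i * fullp n q i * ?F i x" if i: "i \<in> {1..n}" for i
  proof (cases "mixd n ?F q x = 0")
    case True
    then have "fullp n q i * ?F i x = 0"
      using sum_nonneg_eq_0_iff[of "{0..n}" "\<lambda>i. fullp n q i * ?F i x"] i
        fullp_nonneg[OF q] experiment_dens(2)[OF f] by (auto simp: mixd_def)
    then show ?thesis using True by (simp add: mult.assoc)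
  qed (use i in \<open>simp add: postp_def fullp_def\<close>)
  then have "(\<Sum>i=1..n. b i * postp n ?F q i x) * mixd n ?F q x = (\<Sum>i=1..n. b i * fullp n q i * ?F i x)"
    unfolding sum_distrib_right by (intro sum.cong refl) auto
  also have "\<dots> = (\<Sum>i=0..n. (if i = 0 then 0 else b i) * fullp n q i * ?F i x)"
    by (simp add: sum.atLeast_Suc_atMost[of 0])
  finally have "(\<Sum>i=1..n. b i * postp n ?F q i x) * mixd n ?F q x
    = (\<Sum>i=0..n. (if i = 0 then 0 else b i) * fullp n q i * ?F i x)" .
  moreover have "(\<Sum>i=0..n. ((if i = 0 then 0 else b i) - c) * fullp n q i * ?F i x)
    = (\<Sum>i=0..n. (if i = 0 then 0 else b i) * fullp n q i * ?F i x) - c * mixd n ?F q x"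
    by (simp only: mixd_def sum_distrib_left sum_subtractf[symmetric] left_diff_distrib mult.assoc)
  ultimately show ?thesis by (simp only: left_diff_distrib)
qed

text \<open>The nonnegative mixture density moves inside the absolute values. The affine part
  integrates to a number depending only on the prior, so experiments differ only in the integrals of
  absolute linear forms.\<close>

lemma LB_val_abs_affine:
  fixes b :: "nat \<Rightarrow> real"
  assumes f: "is_experiment n xl xu f" and q: "q \<in> tsimplex n"
  defines "\<eta> \<equiv> \<lambda>c i. ((if i = 0 then 0 else b i) - c) * fullp n q i"
  shows "LB_val n xl xu f q b (\<lambda>s. k0 + k1 * s + (\<Sum>j<N. w j * \<bar>s - c j\<bar>))
    = k0 + k1 * (\<Sum>i=0..n. \<eta> 0 i) + (\<Sum>j<(N::nat). w j * (\<integral>x. \<bar>\<Sum>i=0..n. \<eta> (c j) i * dens xl xu f i x\<bar> \<partial>lborel))"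
proof -
  let ?F = "dens xl xu f" and ?m = "mixd n (dens xl xu f) q"
  note F = experiment_dens[OF f]
  note m = mixd_dens[OF f q]
  have eint: "integrable lborel (\<lambda>x. \<Sum>i=0..n. \<eta> c i * ?F i x)" for c
    by (intro Bochner_Integration.integrable_sum integrable_mult_right F)
  have idx: "((\<Sum>i=1..n. b i * postp n ?F q i x) - c) * ?m x = (\<Sum>i=0..n. \<eta> c i * ?F i x)" for c x
    unfolding \<eta>_def by (rule posterior_index_mixd[OF f q])
  have pt: "(k0 + k1 * s + (\<Sum>j<N. w j * \<bar>s - c j\<bar>)) * y
     = k0 * y + k1 * ((s - 0) * y) + (\<Sum>j<N. w j * \<bar>(s - c j) * y\<bar>)" if "0 \<le> y" for s y
    using that by (simp add: distrib_right sum_distrib_right abs_mult mult.assoc)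
  have "LB_val n xl xu f q b (\<lambda>s. k0 + k1 * s + (\<Sum>j<N. w j * \<bar>s - c j\<bar>))
    = (\<integral>x. k0 * ?m x + k1 * (\<Sum>i=0..n. \<eta> 0 i * ?F i x)
        + (\<Sum>j<N. w j * \<bar>\<Sum>i=0..n. \<eta> (c j) i * ?F i x\<bar>) \<partial>lborel)"
    unfolding LB_val_dens pt[OF m(2)] idx ..
  also have "\<dots> = k0 * (\<integral>x. ?m x \<partial>lborel) + k1 * (\<integral>x. (\<Sum>i=0..n. \<eta> 0 i * ?F i x) \<partial>lborel)
        + (\<Sum>j<N. w j * (\<integral>x. \<bar>\<Sum>i=0..n. \<eta> (c j) i * ?F i x\<bar> \<partial>lborel))"
    using m(1) eint by (simp add: Bochner_Integration.integral_sum)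
  also have "(\<integral>x. (\<Sum>i=0..n. \<eta> 0 i * ?F i x) \<partial>lborel) = (\<Sum>i=0..n. \<eta> 0 i)"
    using F by (simp add: Bochner_Integration.integral_sum)
  finally show ?thesis using m(3) by simp
qed

lemma LB_val_close:
  assumes f: "is_experiment n xl xu f" and q: "q \<in> tsimplex n"
    and C: "continuous_on UNIV C" and L: "continuous_on UNIV L"
    and le: "\<And>s. - (\<Sum>i=1..n. \<bar>b i\<bar>) \<le> s \<Longrightarrow> s \<le> (\<Sum>i=1..n. \<bar>b i\<bar>) \<Longrightarrow> C s \<le> L s + e"
  shows "LB_val n xl xu f q b C \<le> LB_val n xl xu f q b L + e"
proof -
  let ?m = "mixd n (dens xl xu f) q"
  let ?s = "\<lambda>x. \<Sum>i=1..n. b i * postp n (dens xl xu f) q i x"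
  note m = mixd_dens[OF f q]
  note s = posterior_index_rules[OF f q, of b]
  have "LB_val n xl xu f q b C \<le> (\<integral>x. L (?s x) * ?m x + e * ?m x \<partial>lborel)"
    unfolding LB_val_dens
  proof (intro integral_mono rules_integrable[OF s C m(1)] Bochner_Integration.integrable_add
      rules_integrable[OF s L m(1)] integrable_mult_right m(1))
    fix x
    show "C (?s x) * ?m x \<le> L (?s x) * ?m x + e * ?m x"
      using mult_right_mono[OF le[OF rulesD(2,3)[OF s]] m(2), of x x] by (simp add: distrib_right)
  qed
  also have "\<dots> = LB_val n xl xu f q b L + e"
    using rules_integrable[OF s L m(1)] m by (simp add: LB_val_dens)
  finally show ?thesis .
qed

lemma LB_ge_if_abs_integral_ge:
  assumes f: "is_experiment n xl xu f" and g: "is_experiment n yl yu g"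
    and abs_ge: "\<And>c. (\<integral>y. \<bar>\<Sum>i=0..n. c i * dens yl yu g i y\<bar> \<partial>lborel)
      \<le> (\<integral>x. \<bar>\<Sum>i=0..n. c i * dens xl xu f i x\<bar> \<partial>lborel)"
  shows "LB_ge n xl xu f yl yu g"
  unfolding LB_ge_def
proof (intro ballI allI impI)
  fix q and b :: "nat \<Rightarrow> real" and C :: "real \<Rightarrow> real"
  assume q: "q \<in> tsimplex n" and C: "convex_on UNIV C"
  have Cc: "continuous_on UNIV C" by (rule convex_on_continuous[OF _ C]) simp
  show "LB_val n yl yu g q b C \<le> LB_val n xl xu f q b C"
  proof (rule field_le_epsilon)
    fix e :: real assume "0 < e"
    then have "0 < e / 2" by simp
    then obtain N k0 k1 w c where w: "\<And>j. 0 \<le> w j"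
      and approx: "\<And>s. - (\<Sum>i=1..n. \<bar>b i\<bar>) \<le> s \<Longrightarrow> s \<le> (\<Sum>i=1..n. \<bar>b i\<bar>) \<Longrightarrow>
        \<bar>C s - (k0 + k1 * s + (\<Sum>j<(N::nat). w j * \<bar>s - c j\<bar>))\<bar> \<le> e / 2"
      by (rule convex_abs_approximation[OF C, where R = "\<Sum>i=1..n. \<bar>b i\<bar>"]) blast
    define L where "L s = k0 + k1 * s + (\<Sum>j<N. w j * \<bar>s - c j\<bar>)" for s
    have CL: "C s \<le> L s + e / 2" "L s \<le> C s + e / 2"
      if "- (\<Sum>i=1..n. \<bar>b i\<bar>) \<le> s" "s \<le> (\<Sum>i=1..n. \<bar>b i\<bar>)" for s
      using approx[OF that] unfolding L_def by linarith+
    have Lc: "continuous_on UNIV L" unfolding L_def by (intro continuous_intros)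
    have "LB_val n yl yu g q b C \<le> LB_val n yl yu g q b L + e / 2"
      by (rule LB_val_close[OF g q Cc Lc CL(1)])
    also have "LB_val n yl yu g q b L \<le> LB_val n xl xu f q b L"
      unfolding L_def LB_val_abs_affine[OF f q] LB_val_abs_affine[OF g q]
      by (intro add_left_mono sum_mono mult_left_mono abs_ge w)
    also have "LB_val n xl xu f q b L \<le> LB_val n xl xu f q b C + e / 2"
      by (rule LB_val_close[OF f q Lc Cc CL(2)])
    finally show "LB_val n yl yu g q b C \<le> LB_val n xl xu f q b C + e" by simp
  qed
qed

subsection \<open>Two-type screening environments\<close>

text \<open>Dropping the mass at state 0 loses nothing, since \<open>fullp\<close> restores it as
  the residual of a total of 1.\<close>

lemma distribution_as_fullp:
  fixes r :: "nat \<Rightarrow> real"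
  assumes "\<And>i. 0 \<le> r i" "sum r {0..n} = 1"
  defines "p \<equiv> \<lambda>i. if i \<in> {1..n} then r i else 0"
  shows "p \<in> tsimplex n" "i \<in> {0..n} \<Longrightarrow> fullp n p i = r i"
proof -
  have "sum p {1..n} = sum r {1..n}" unfolding p_def by (rule sum.cong) auto
  then have sp: "sum p {1..n} = 1 - r 0" using assms(2) by (simp add: sum.atLeast_Suc_atMost)
  have "r i \<le> 1" if "i \<in> {1..n}" for i
    using member_le_sum[of i "{0..n}" r] assms(1,2) that by auto
  then show "p \<in> tsimplex n" using assms(1) sp by (auto simp: tsimplex_def p_def)
  show "fullp n p i = r i" if "i \<in> {0..n}" using that sp by (auto simp: fullp_def) (simp add: p_def)
qed

text \<open>Without cancellation the integral is the same for every experiment. This settles the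
  coefficient vectors whose positive or negative part is 0 and cannot be normalised to a
  belief.\<close>

lemma abs_integral_same_sign:
  assumes f: "is_experiment n xl xu f"
    and e: "(\<forall>i\<in>{0..n}. 0 \<le> e i) \<or> (\<forall>i\<in>{0..n}. e i \<le> 0)"
  shows "(\<integral>x. \<bar>\<Sum>i=0..n. e i * dens xl xu f i x\<bar> \<partial>lborel) = (\<Sum>i=0..n. \<bar>e i\<bar>)"
proof -
  note F = experiment_dens[OF f]
  have "\<bar>\<Sum>i=0..n. e i * dens xl xu f i x\<bar> = (\<Sum>i=0..n. \<bar>e i\<bar> * dens xl xu f i x)" for x
    using e
  proof
    assume e: "\<forall>i\<in>{0..n}. 0 \<le> e i"
    then have "0 \<le> (\<Sum>i=0..n. e i * dens xl xu f i x)" using F(2) by (intro sum_nonneg) auto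
    moreover have "(\<Sum>i=0..n. \<bar>e i\<bar> * dens xl xu f i x) = (\<Sum>i=0..n. e i * dens xl xu f i x)"
      using e by (intro sum.cong) auto
    ultimately show ?thesis by simp
  next
    assume e: "\<forall>i\<in>{0..n}. e i \<le> 0"
    then have "(\<Sum>i=0..n. e i * dens xl xu f i x) \<le> 0"
      using F(2) by (intro sum_nonpos) (auto intro: mult_nonpos_nonneg)
    moreover have "(\<Sum>i=0..n. \<bar>e i\<bar> * dens xl xu f i x) = - (\<Sum>i=0..n. e i * dens xl xu f i x)"
      unfolding sum_negf[symmetric] using e by (intro sum.cong) auto
    ultimately show ?thesis by simp
  qed
  then show ?thesis using F by (simp add: Bochner_Integration.integral_sum)
qed

text \<open>One alternative, a signal that is always observed and a linear cost leave expected
  transfers as the only concern of the principal.\<close>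

lemma two_type_env:
  assumes p: "p \<in> tsimplex n" "p' \<in> tsimplex n" "p \<noteq> p'"
  shows "screening_env n 0 (\<lambda>i. (p i + p' i) / 2) {p, p'} (\<lambda>_. 1/2) (\<lambda>_. 1) (\<lambda>t. t) (-1) 1"
proof -
  have "(\<lambda>i. (p i + p' i) / 2) \<in> tsimplex n"
    using p(1,2) by (fastforce simp: tsimplex_def sum.distrib sum_divide_distrib[symmetric])
  then show ?thesis
    using p by (auto simp: screening_env_def convex_on_def continuous_on_id)
qed

section \<open>Payoffs with a single alternative and a certain signal\<close>

lemma agentU_single:
  assumes "ah r 0 = 1"
  shows "agentU n xl xu f 0 (\<lambda>_. 1) u1 ah t p r
    = (\<Sum>i=0..n. fullp n p i * u1 0 i)
      + (\<Sum>i=0..n. fullp n p i * (\<integral>x. t r 0 (Some x) * dens xl xu f i x \<partial>lborel))"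
  using assms by (simp add: agentU_def LINT_dens[where f = f] sum.distrib distrib_left)

lemma principal_obj_single:
  assumes "p \<noteq> p'" "ah p 0 = 1" "ah p' 0 = 1"
  shows "principal_obj n xl xu f 0 {p, p'} (\<lambda>_. 1/2) (\<lambda>_. 1) (\<lambda>_ _. 0) (\<lambda>t. t) ah t
    = - ((\<Sum>i=0..n. fullp n p i * (\<integral>x. t p 0 (Some x) * dens xl xu f i x \<partial>lborel))
       + (\<Sum>i=0..n. fullp n p' i * (\<integral>x. t p' 0 (Some x) * dens xl xu f i x \<partial>lborel))) / 2"
  using assms by (simp add: principal_obj_def LINT_dens[where f = f] sum_negf)

text \<open>Write \<open>e = \<alpha> r - \<beta> r'\<close> with beliefs \<open>r\<close>,
  \<open>r'\<close>. Under \<open>G\<close> the sign rule pays the two types \<open>A\<close> and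
  \<open>B\<close> in expectation, with \<open>\<alpha> A - \<beta> B = SG\<close>. Under
  \<open>F\<close> a rule for the first type that pays it at least \<open>A\<close> is worth at
  least \<open>B + (SG - SF) / \<beta>\<close> to the second, because transfers in
  \<open>[-1, 1]\<close> give at most \<open>SF\<close> for the same combination.\<close>

lemma Wval_ge_imp_abs_integral_ge:
  assumes f: "is_experiment n xl xu f" and g: "is_experiment n yl yu g"
    and W: "\<And>(k::nat) q P \<pi> \<psi> v1 v2 u1 mlo mhi. screening_env n k q P \<pi> \<psi> v2 mlo mhi \<Longrightarrow>
       Wval n yl yu g k P \<pi> \<psi> v1 v2 u1 mlo mhi \<le> Wval n xl xu f k P \<pi> \<psi> v1 v2 u1 mlo mhi"
  shows "(\<integral>y. \<bar>\<Sum>i=0..n. e i * dens yl yu g i y\<bar> \<partial>lborel)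
    \<le> (\<integral>x. \<bar>\<Sum>i=0..n. e i * dens xl xu f i x\<bar> \<partial>lborel)"
proof (cases "(\<forall>i\<in>{0..n}. 0 \<le> e i) \<or> (\<forall>i\<in>{0..n}. e i \<le> 0)")
  case True
  then show ?thesis by (simp add: abs_integral_same_sign[OF f True] abs_integral_same_sign[OF g True])
next
  case False
  let ?F = "dens xl xu f" and ?G = "dens yl yu g"
  note F = experiment_dens[OF f] and G = experiment_dens[OF g]
  obtain i1 i2 where i1: "i1 \<in> {0..n}" "e i1 < 0" and i2: "i2 \<in> {0..n}" "0 < e i2"
    using False by (meson not_le)
  define \<alpha> where "\<alpha> = (\<Sum>i=0..n. max 0 (e i))"
  define \<beta> where "\<beta> = (\<Sum>i=0..n. max 0 (- e i))"
  have "max 0 (e i2) \<le> \<alpha>" unfolding \<alpha>_def using i2 by (intro member_le_sum) auto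
  then have \<alpha>: "0 < \<alpha>" using i2 by simp
  have "max 0 (- e i1) \<le> \<beta>" unfolding \<beta>_def using i1 by (intro member_le_sum) auto
  then have \<beta>: "0 < \<beta>" using i1 by simp
  define r where "r i = max 0 (e i) / \<alpha>" for i
  define r' where "r' i = max 0 (- e i) / \<beta>" for i
  have r: "0 \<le> r i" "sum r {0..n} = 1" for i
    using \<alpha> unfolding r_def by (auto simp: sum_divide_distrib[symmetric] \<alpha>_def[symmetric])
  have r': "0 \<le> r' i" "sum r' {0..n} = 1" for i
    using \<beta> unfolding r'_def by (auto simp: sum_divide_distrib[symmetric] \<beta>_def[symmetric])
  have e_eq: "e i = \<alpha> * r i - \<beta> * r' i" for i
    using \<alpha> \<beta> by (simp add: r_def r'_def)
  define p where "p i = (if i \<in> {1..n} then r i else 0)" for i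
  define p' where "p' i = (if i \<in> {1..n} then r' i else 0)" for i
  have p: "p \<in> tsimplex n" "\<And>i. i \<in> {0..n} \<Longrightarrow> fullp n p i = r i"
    using distribution_as_fullp[OF r] by (simp_all add: p_def[abs_def])
  have p': "p' \<in> tsimplex n" "\<And>i. i \<in> {0..n} \<Longrightarrow> fullp n p' i = r' i"
    using distribution_as_fullp[OF r'] by (simp_all add: p'_def[abs_def])
  have "r i2 \<noteq> r' i2" using i2 \<alpha> by (simp add: r_def r'_def)
  then have ne: "p \<noteq> p'" using p(2)[OF i2(1)] p'(2)[OF i2(1)] by auto
  \<comment> \<open>Among transfers in \<open>[-1, 1]\<close> the sign maximises the integral
    against the linear form, with value \<open>SG\<close>.\<close>
  define t0 where "t0 y = sgn (\<Sum>i=0..n. e i * ?G i y)" for y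
  have t0: "t0 \<in> rules lborel (-1) 1"
  proof -
    have "(\<lambda>y. \<Sum>i=0..n. e i * ?G i y) \<in> borel_measurable lborel"
      by (intro borel_measurable_sum borel_measurable_times borel_measurable_const borel_measurable_integrable G)
    then have "t0 \<in> borel_measurable lborel" unfolding t0_def by measurable
    then show ?thesis by (auto simp: rules_def t0_def sgn_if)
  qed
  define A where "A = (\<Sum>i=0..n. r i * (\<integral>y. t0 y * ?G i y \<partial>lborel))"
  define B where "B = (\<Sum>i=0..n. r' i * (\<integral>y. t0 y * ?G i y \<partial>lborel))"
  define SF where "SF = (\<integral>x. \<bar>\<Sum>i=0..n. e i * ?F i x\<bar> \<partial>lborel)"
  define SG where "SG = (\<integral>y. \<bar>\<Sum>i=0..n. e i * ?G i y\<bar> \<partial>lborel)"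
  have combine: "\<alpha> * (\<Sum>i=0..n. r i * z i) - \<beta> * (\<Sum>i=0..n. r' i * z i) = (\<Sum>i=0..n. e i * z i)" for z
    by (simp add: e_eq sum_distrib_left sum_subtractf left_diff_distrib mult.assoc)
  have AB: "\<alpha> * A - \<beta> * B = SG"
  proof -
    have "\<alpha> * A - \<beta> * B = (\<integral>y. t0 y * (\<Sum>i=0..n. e i * ?G i y) \<partial>lborel)"
      unfolding A_def B_def combine
      using rules_weighted_integral[OF g t0 continuous_on_id, of e] by simp
    then show ?thesis by (simp add: t0_def SG_def linordered_idom_class.abs_sgn mult.commute)
  qed
  have Bge: "- 1 \<le> B"
  proof -
    have "- 1 \<le> (\<integral>y. t0 y * ?G i y \<partial>lborel)" if "i \<in> {0..n}" for i
    proof -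
      have "(\<integral>y. - 1 * ?G i y \<partial>lborel) \<le> (\<integral>y. t0 y * ?G i y \<partial>lborel)"
      proof (rule integral_mono)
        show "integrable lborel (\<lambda>y. - 1 * ?G i y)" using G(1)[OF that] by simp
        show "integrable lborel (\<lambda>y. t0 y * ?G i y)"
          using rules_integrable[OF t0 continuous_on_id G(1)[OF that]] by simp
        show "- 1 * ?G i y \<le> t0 y * ?G i y" for y
          by (rule mult_right_mono[OF rulesD(2)[OF t0] G(2)[OF that]])
      qed
      then show ?thesis using G(3)[OF that] by simp
    qed
    then have "(\<Sum>i=0..n. r' i * - 1) \<le> B"
      unfolding B_def using r'(1) by (intro sum_mono mult_left_mono) auto
    then show ?thesis using r'(2) by (simp add: sum_negf)
  qed
  \<comment> \<open>The type with belief \<open>r\<close> lives on states with positive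
    \<open>e\<close>, where \<open>- A\<close> makes its participation bind. The other lives on
    negative \<open>e\<close>, where the constant 1 suffices because \<open>- 1 \<le> B\<close>.
    States with \<open>e i = 0\<close> have probability 0 for both.\<close>
  define u1 where "u1 a i = (if 0 < e i then - A else 1)" for a i :: nat
  have u_p: "(\<Sum>i=0..n. fullp n p i * u1 0 i) = - A"
  proof -
    have "(\<Sum>i=0..n. fullp n p i * u1 0 i) = (\<Sum>i=0..n. r i * - A)"
      by (rule sum.cong) (auto simp: p(2) u1_def r_def)
    then show ?thesis using r(2) by (simp add: sum_distrib_right[symmetric] sum_negf)
  qed
  have u_p': "(\<Sum>i=0..n. fullp n p' i * u1 0 i) = 1"
  proof -
    have "(\<Sum>i=0..n. fullp n p' i * u1 0 i) = (\<Sum>i=0..n. r' i)"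
      by (rule sum.cong) (auto simp: p'(2) u1_def r'_def)
    then show ?thesis using r'(2) by simp
  qed
  have fp: "(\<Sum>i=0..n. fullp n p i * z i) = (\<Sum>i=0..n. r i * z i)"
    and fp': "(\<Sum>i=0..n. fullp n p' i * z i) = (\<Sum>i=0..n. r' i * z i)" for z
    by (auto intro!: sum.cong simp: p(2) p'(2))
  let ?v1 = "\<lambda>_ _. 0 :: real"
  let ?WF = "Wval n xl xu f 0 {p, p'} (\<lambda>_. 1/2) (\<lambda>_. 1) ?v1 (\<lambda>t. t) u1 (-1) 1"
  let ?WG = "Wval n yl yu g 0 {p, p'} (\<lambda>_. 1/2) (\<lambda>_. 1) ?v1 (\<lambda>t. t) u1 (-1) 1"
  \<comment> \<open>Both reports receive \<open>t0\<close>, so incentive compatibility is trivial;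
    the value 0 at \<open>None\<close> is a default that occurs with probability 0.\<close>
  have lower: "ereal (- (A + B) / 2) \<le> ?WG"
  proof -
    define t where "t = (\<lambda>(_ :: nat \<Rightarrow> real) (_ :: nat) z. case z of None \<Rightarrow> 0 | Some y \<Rightarrow> t0 y)"
    define ah where "ah = (\<lambda>(_ :: nat \<Rightarrow> real) (_ :: nat). 1 :: real)"
    have Up: "agentU n yl yu g 0 (\<lambda>_. 1) u1 ah t p s = 0"
      and Up': "agentU n yl yu g 0 (\<lambda>_. 1) u1 ah t p' s = 1 + B" for s
      by (simp_all add: agentU_single ah_def u_p u_p' fp fp' t_def A_def B_def del: sum.atLeast0_atMost_Suc)
    have "feasible n yl yu g 0 {p, p'} (\<lambda>_. 1) u1 (-1) 1 ah t"
      unfolding feasible_def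
    proof (intro conjI ballI)
      show "set_borel_measurable lborel {yl..yu} (\<lambda>x. t s a (Some x))" for s a
        unfolding t_def set_borel_measurable_def using rulesD(1)[OF t0] by simp
    qed (use rulesD(2,3)[OF t0] Up Up' Bge in \<open>auto simp: t_def ah_def\<close>)
    moreover have "principal_obj n yl yu g 0 {p, p'} (\<lambda>_. 1/2) (\<lambda>_. 1) ?v1 (\<lambda>t. t) ah t = - (A + B) / 2"
      using principal_obj_single[OF ne, of ah n yl yu g t] by (simp add: ah_def fp fp' t_def A_def B_def)
    ultimately show ?thesis
      unfolding Wval_def by (intro SUP_upper2[where i = "(ah, t)"]) auto
  qed
  have upper: "?WF \<le> ereal (- (A + B + (SG - SF) / \<beta>) / 2)"
    unfolding Wval_def
  proof (rule SUP_least)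
    fix m assume "m \<in> {(ah, t). feasible n xl xu f 0 {p, p'} (\<lambda>_. 1) u1 (-1) 1 ah t}"
    then obtain ah t where m: "m = (ah, t)" and feas: "feasible n xl xu f 0 {p, p'} (\<lambda>_. 1) u1 (-1) 1 ah t"
      by auto
    have ah: "ah p 0 = 1" "ah p' 0 = 1" using feas by (auto simp: feasible_def)
    define X where "X s z = (\<Sum>i=0..n. z i * (\<integral>x. t s 0 (Some x) * ?F i x \<partial>lborel))" for s z
    \<comment> \<open>Two constraints suffice: participation of \<open>p\<close>, and that
      \<open>p'\<close> does not gain by reporting \<open>p\<close>.\<close>
    have "0 \<le> agentU n xl xu f 0 (\<lambda>_. 1) u1 ah t p p"
      "agentU n xl xu f 0 (\<lambda>_. 1) u1 ah t p' p \<le> agentU n xl xu f 0 (\<lambda>_. 1) u1 ah t p' p'"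
      using feas unfolding feasible_def by blast+
    then have ir: "A \<le> X p r" and ic: "X p r' \<le> X p' r'"
      unfolding agentU_single[of ah, OF ah(1)] agentU_single[of ah, OF ah(2)] u_p u_p' fp fp' X_def by simp_all
    let ?t = "clip (-1) xl xu (\<lambda>x. t p 0 (Some x))"
    have tr: "?t \<in> rules lborel (-1) 1"
      using feas unfolding feasible_def by (intro clip_rules) auto
    have "\<alpha> * X p r - \<beta> * X p r' = (\<Sum>i=0..n. e i * (\<integral>x. ?t x * ?F i x \<partial>lborel))"
      unfolding X_def combine clip_dens[of "\<lambda>z. z"] ..
    also have "\<dots> = (\<integral>x. ?t x * (\<Sum>i=0..n. e i * ?F i x) \<partial>lborel)"
      using rules_weighted_integral[OF f tr continuous_on_id, of e] by simp
    also have "\<dots> \<le> SF"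
      unfolding SF_def
    proof (rule integral_mono)
      have int: "integrable lborel (\<lambda>x. \<Sum>i=0..n. e i * ?F i x)"
        by (intro Bochner_Integration.integrable_sum integrable_mult_right F)
      then show "integrable lborel (\<lambda>x. \<bar>\<Sum>i=0..n. e i * ?F i x\<bar>)" by simp
      show "integrable lborel (\<lambda>x. ?t x * (\<Sum>i=0..n. e i * ?F i x))"
        using rules_integrable[OF tr continuous_on_id int] by simp
      fix x
      have "\<bar>?t x\<bar> * \<bar>\<Sum>i=0..n. e i * ?F i x\<bar> \<le> 1 * \<bar>\<Sum>i=0..n. e i * ?F i x\<bar>"
        using rulesD(4)[OF tr, of x] by (intro mult_right_mono) auto
      then show "?t x * (\<Sum>i=0..n. e i * ?F i x) \<le> \<bar>\<Sum>i=0..n. e i * ?F i x\<bar>"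
        by (simp add: abs_mult[symmetric])
    qed
    finally have "\<alpha> * X p r - \<beta> * X p r' \<le> SF" .
    moreover have "\<alpha> * A \<le> \<alpha> * X p r" using ir \<alpha> by simp
    ultimately have "\<beta> * B + (SG - SF) \<le> \<beta> * X p r'" using AB by linarith
    then have "B + (SG - SF) / \<beta> \<le> X p r'" using \<beta> by (simp add: field_simps)
    then have "A + B + (SG - SF) / \<beta> \<le> X p r + X p' r'" using ir ic by linarith
    then have "- (X p r + X p' r') / 2 \<le> - (A + B + (SG - SF) / \<beta>) / 2"
      by (intro divide_right_mono le_imp_neg_le) auto
    then show "ereal (principal_obj n xl xu f 0 {p, p'} (\<lambda>_. 1/2) (\<lambda>_. 1) ?v1 (\<lambda>t. t) (fst m) (snd m))
        \<le> ereal (- (A + B + (SG - SF) / \<beta>) / 2)"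
      unfolding m fst_conv snd_conv principal_obj_single[of p p' ah, OF ne ah] fp fp' X_def by simp
  qed
  \<comment> \<open>Comparing the two bounds leaves
    \<open>(SG - SF) / \<beta> \<le> 0\<close>.\<close>
  have "ereal (- (A + B) / 2) \<le> ereal (- (A + B + (SG - SF) / \<beta>) / 2)"
    using order_trans[OF order_trans[OF lower W[OF two_type_env[OF p(1) p'(1) ne]]] upper] .
  then have "SG \<le> SF" using \<beta> by (simp add: divide_le_0_iff)
  then show ?thesis by (simp add: SF_def SG_def)
qed

section \<open>The equivalence, closing the circle through integrals of absolute linear
  forms\<close>

theorem theorem3:
  fixes n :: nat and xl xu yl yu :: real and f g :: "nat \<Rightarrow> real \<Rightarrow> real"
  assumes "is_experiment n xl xu f" and "is_experiment n yl yu g"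
  shows "LB_ge n xl xu f yl yu g \<longleftrightarrow>
    (\<forall>(k::nat) (q::nat \<Rightarrow> real) (P::(nat \<Rightarrow> real) set) (\<pi>::(nat \<Rightarrow> real) \<Rightarrow> real)
        (\<psi>::nat \<Rightarrow> real) (v1::nat \<Rightarrow> nat \<Rightarrow> real) (v2::real \<Rightarrow> real) (u1::nat \<Rightarrow> nat \<Rightarrow> real)
        (mlo::real) (mhi::real).
       screening_env n k q P \<pi> \<psi> v2 mlo mhi \<longrightarrow>
       Wval n xl xu f k P \<pi> \<psi> v1 v2 u1 mlo mhi \<ge> Wval n yl yu g k P \<pi> \<psi> v1 v2 u1 mlo mhi)"
proof
  assume "LB_ge n xl xu f yl yu g"
  then show "\<forall>k q P \<pi> \<psi> v1 v2 u1 mlo mhi. screening_env n k q P \<pi> \<psi> v2 mlo mhi \<longrightarrow>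
       Wval n xl xu f k P \<pi> \<psi> v1 v2 u1 mlo mhi \<ge> Wval n yl yu g k P \<pi> \<psi> v1 v2 u1 mlo mhi"
    by (intro allI impI LB_ge_imp_Wval_ge[OF assms])
next
  assume "\<forall>k q P \<pi> \<psi> v1 v2 u1 mlo mhi. screening_env n k q P \<pi> \<psi> v2 mlo mhi \<longrightarrow>
       Wval n xl xu f k P \<pi> \<psi> v1 v2 u1 mlo mhi \<ge> Wval n yl yu g k P \<pi> \<psi> v1 v2 u1 mlo mhi"
  then show "LB_ge n xl xu f yl yu g"
    by (intro LB_ge_if_abs_integral_ge[OF assms] Wval_ge_imp_abs_integral_ge[OF assms]) simp
qed

end
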